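(* Let $u,v\in S_n$ and $\mathbf{a}\in[n]^n$. If $\mathcal{T}_{u,v,\mathbf{a}}\neq\emptyset$ or $\mathcal{T}^\circ_{u,v,\mathbf{a}}\neq\emptyset$, then $u\le_{\mathbf{a}}v$. Furthermore, if $u\le_{\mathbf{a}}v$, then the set of $T$-fixed points of $\mathcal{T}_{u,v,\mathbf{a}}$ is exactly $\{e_w: w\in[u,v]\}$.
   Context: $\mathrm{Fl}_n$ is the variety of complete flags $F_\bullet$ in $\mathbb{C}^n$, identified with $GL_n(\mathbb{C})/B$ ($B$ upper triangular); a flag is represented by an invertible matrix whose first $k$ columns span $F_k$. $T$ is the torus of diagonal matrices acting by left multiplication; for $w\in S_n$, $e_w$ is the flag represented by the permutation matrix with $1$ in positions $(w_k,k)$. For $S\subseteq[n]$, $\mathrm{rank}_S(F_k)$ is the rank of the submatrix of a representative with rows $S$ and the first $k$ columns. Permutations are in one-line notation, $w[k]:=\{w_1,\dots,w_k\}$. Cyclic interval $[a,b)_c$: $\{a,\dots,b-1\}$ if $a\le b$ (empty if $a=b$), $\{a,\dots,n\}\cup\{1,\dots,b-1\}$ if $a>b$. For $\mathbf{a}\in[n]^n$, $\mathcal{T}_{u,v,\mathbf{a}}:=\{F_\bullet:\mathrm{rank}_{[a_k,i)_c}(F_k)\le|u[k]\cap[a_k,i)_c|,\ \mathrm{rank}_{[i,a_k)_c}(F_k)\le|v[k]\cap[i,a_k)_c|\ \forall i,k\in[n]\}$, and $\mathcal{T}^\circ_{u,v,\mathbf{a}}$ is defined by the same conditions with all $\le$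 replaced by $=$. For $r\in[n]$, $<_r$ is the total order $r<_r r+1<_r\cdots<_r n<_r 1<_r\cdots<_r r-1$; for $k$-subsets $A=\{a_1<_r\cdots<_r a_k\}$, $B=\{b_1<_r\cdots<_r b_k\}$, $A\le_r B$ means $a_i\le_r b_i$ for all $i$; $u\le_{\mathbf{a}}v$ means $u[k]\le_{a_k}v[k]$ for all $k$. Quantum Bruhat graph $\Gamma_n$: directed graph on $S_n$ with an edge $w\to wt_{ij}$ ($i<j$, $wt_{ij}$ swaps positions $i,j$) whenever $\ell(wt_{ij})=\ell(w)+1$ or $\ell(wt_{ij})=\ell(w)+1-2(j-i)$, $\ell$ = number of inversions; $\ell(x,y)$ is the shortest path length from $x$ to $y$, and the tilted Bruhat interval is $[u,v]:=\{w:\ell(u,w)+\ell(w,v)=\ell(u,v)\}$. *)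

theory Defs
  imports
    "Jordan_Normal_Form.DL_Rank_Submatrix"
    "HOL-Combinatorics.Permutations"
    "HOL-Library.Extended_Nat"
begin

text \<open>
  Elements of \<open>[n]\<close> are the natural numbers \<open>1, \<dots>, n\<close>, and a permutation in \<open>S\<^sub>n\<close> is a function
  \<open>w\<close> with \<open>w permutes {1..n}\<close>.  Matrix entries are indexed from \<open>0\<close>, so the row and column with
  number \<open>i\<close> in \<open>[n]\<close> have matrix index \<open>i - 1\<close>.
\<close>

subsection \<open>Complete flags and the torus action\<close>

abbreviation Cvs :: "nat \<Rightarrow> (complex, complex vec) module"
  where "Cvs n \<equiv> module_vec TYPE(complex) n"

text \<open>
  A flag is a sequence \<open>F 0 \<subseteq> F 1 \<subseteq> \<dots> \<subseteq> F n\<close> with \<open>dim (F k) = k\<close>.  It is indexed by all natural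
  numbers: the condition below forces \<open>F k\<close> to be the whole space for \<open>k \<ge> n\<close>, so that equality of
  functions is equality of flags.
\<close>

definition complete_flag :: "nat \<Rightarrow> (nat \<Rightarrow> complex vec set) \<Rightarrow> bool"
  where "complete_flag n F \<longleftrightarrow>
    (\<forall>k. VectorSpace.subspace class_ring (F k) (Cvs n) \<and>
         vectorspace.dim class_ring ((Cvs n)\<lparr>carrier := F k\<rparr>) = min k n \<and>
         F k \<subseteq> F (Suc k))"

definition flag_of_mat :: "nat \<Rightarrow> complex mat \<Rightarrow> nat \<Rightarrow> complex vec set"
  where "flag_of_mat n M k =
    LinearCombinations.module.span class_ring (Cvs n) (set (take k (cols M)))"

definition represents :: "nat \<Rightarrow> complex mat \<Rightarrow> (nat \<Rightarrow> complex vec set) \<Rightarrow> bool"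
  where "represents n M F \<longleftrightarrow> M \<in> carrier_mat n n \<and> invertible_mat M \<and> F = flag_of_mat n M"

definition torus :: "nat \<Rightarrow> complex mat set"
  where "torus n = {D \<in> carrier_mat n n. diagonal_mat D \<and> invertible_mat D}"

definition act_flag :: "complex mat \<Rightarrow> (nat \<Rightarrow> complex vec set) \<Rightarrow> nat \<Rightarrow> complex vec set"
  where "act_flag D F k = (\<lambda>v. D *\<^sub>v v) ` F k"

definition torus_fixed_points ::
    "nat \<Rightarrow> (nat \<Rightarrow> complex vec set) set \<Rightarrow> (nat \<Rightarrow> complex vec set) set"
  where "torus_fixed_points n X = {F \<in> X. \<forall>D\<in>torus n. act_flag D F = F}"

definition perm_flag :: "nat \<Rightarrow> (nat \<Rightarrow> nat) \<Rightarrow> nat \<Rightarrow> complex vec set"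
  where "perm_flag n w =
    flag_of_mat n (mat n n (\<lambda>(i, j). if Suc i = w (Suc j) then 1 else 0))"

subsection \<open>The rank of a flag on a set of rows\<close>

definition mat_rank_rows :: "nat set \<Rightarrow> complex mat \<Rightarrow> nat \<Rightarrow> nat"
  where "mat_rank_rows S M k =
    (let A = submatrix M {i. Suc i \<in> S} {..<k} in vec_space.rank (dim_row A) A)"

definition flag_rank :: "nat \<Rightarrow> nat set \<Rightarrow> (nat \<Rightarrow> complex vec set) \<Rightarrow> nat \<Rightarrow> nat"
  where "flag_rank n S F k = mat_rank_rows S (SOME M. represents n M F) k"

text \<open>The rank does not depend on the chosen representative.\<close>

lemma cols_submatrix_UNIV_lessThan:
  fixes M :: "'a mat"
  assumes "k \<le> dim_col M"
  shows "cols (submatrix M UNIV {..<k}) = take k (cols M)"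
proof (rule nth_equalityI)
  have "{j. j < dim_col M \<and> j \<in> {..<k}} = {..<k}"
    using assms by auto
  then have k: "dim_col (submatrix M UNIV {..<k}) = k"
    by (simp only: dim_submatrix card_lessThan)
  show len: "length (cols (submatrix M UNIV {..<k})) = length (take k (cols M))"
    using assms k by simp
  fix j assume "j < length (cols (submatrix M UNIV {..<k}))"
  then have j: "j < k"
    using k by simp
  have "pick {..<k} j = j"
    using pick_reduce_set[of j k UNIV] j by (simp add: pick_UNIV lessThan_def)
  then have "submatrix M UNIV {..<k} $$ (i, j) = M $$ (i, j)" if "i < dim_row M" for i
    using submatrix_index[of i M UNIV j "{..<k}"] j k that
    by (simp add: dim_submatrix(2) pick_UNIV)
  then have "col (submatrix M UNIV {..<k}) j = col M j"
    using j k assms by (intro eq_vecI) (simp_all add: dim_submatrix(1))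
  then show "cols (submatrix M UNIV {..<k}) ! j = take k (cols M) ! j"
    using j k assms by simp
qed

lemma span_cols_eq_image:
  fixes B :: "complex mat"
  assumes "B \<in> carrier_mat n m"
  shows "LinearCombinations.module.span class_ring (Cvs n) (set (cols B)) =
    (\<lambda>x. B *\<^sub>v x) ` carrier_vec m"
proof -
  interpret V: vec_space "TYPE(complex)" n .
  have "B *\<^sub>v x \<in> carrier_vec n" if "x \<in> carrier_vec m" for x
    using assms that by (rule mult_mat_vec_carrier)
  moreover have "V.span (set (cols B)) = {y \<in> carrier_vec n. \<exists>x\<in>carrier_vec m. B *\<^sub>v x = y}"
    using V.col_space_eq[OF assms] carrier_matD[OF assms] unfolding V.col_space_def by simp
  ultimately show ?thesis
    by auto
qed

lemma submatrix_mult_vec: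
  fixes B :: "complex mat" and I :: "nat set"
  assumes "B \<in> carrier_mat n m" and "x \<in> carrier_vec m"
  shows "submatrix B I UNIV *\<^sub>v x =
    vec (card {i. i < n \<and> i \<in> I}) (\<lambda>i. (B *\<^sub>v x) $ pick I i)"
proof (rule eq_vecI)
  fix i assume "i < dim_vec (vec (card {i. i < n \<and> i \<in> I}) (\<lambda>i. (B *\<^sub>v x) $ pick I i))"
  then have i: "i < card {i. i < dim_row B \<and> i \<in> I}"
    using assms by simp
  then have p: "pick I i < dim_row B"
    by (rule pick_le)
  have "(submatrix B I UNIV *\<^sub>v x) $ i = row B (pick I i) \<bullet> x"
    using i row_submatrix_UNIV[OF i] by (simp add: dim_submatrix(1))
  then show "(submatrix B I UNIV *\<^sub>v x) $ i =
      vec (card {i. i < n \<and> i \<in> I}) (\<lambda>i. (B *\<^sub>v x) $ pick I i) $ i"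
    using i p assms by simp
qed (use assms in \<open>simp add: dim_submatrix(1)\<close>)

lemma span_cols_submatrix:
  fixes B :: "complex mat" and I :: "nat set"
  assumes B: "B \<in> carrier_mat n m"
  defines "d \<equiv> card {i. i < n \<and> i \<in> I}"
  shows "LinearCombinations.module.span class_ring (Cvs d) (set (cols (submatrix B I UNIV))) =
    (\<lambda>v. vec d (\<lambda>i. v $ pick I i)) `
      LinearCombinations.module.span class_ring (Cvs n) (set (cols B))"
proof -
  have "submatrix B I UNIV \<in> carrier_mat d m"
    using B by (intro carrier_matI) (simp_all add: dim_submatrix d_def)
  moreover have "(\<lambda>x. submatrix B I UNIV *\<^sub>v x) ` carrier_vec m =
      (\<lambda>x. vec d (\<lambda>i. (B *\<^sub>v x) $ pick I i)) ` carrier_vec m"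
    unfolding d_def by (rule image_cong[OF refl]) (rule submatrix_mult_vec[OF B])
  ultimately show ?thesis
    using B by (simp only: span_cols_eq_image image_image)
qed

lemma mat_rank_rows_eq:
  fixes S :: "nat set"
  assumes M: "M \<in> carrier_mat n n" and k: "k \<le> n"
  defines "m \<equiv> card {i. i < n \<and> Suc i \<in> S}"
  shows "mat_rank_rows S M k = vectorspace.dim class_ring ((Cvs m)\<lparr>carrier :=
    (\<lambda>v. vec m (\<lambda>i. v $ pick {i. Suc i \<in> S} i)) ` flag_of_mat n M k\<rparr>)"
proof -
  let ?I = "{i. Suc i \<in> S}"
  define B where "B = submatrix M UNIV {..<k}"
  define A where "A = submatrix B ?I UNIV"
  have A: "A = submatrix M ?I {..<k}"
    unfolding A_def B_def by (rule submatrix_split[symmetric])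
  have B: "B \<in> carrier_mat n (dim_col B)"
    using M by (auto simp: B_def dim_submatrix)
  have m: "dim_row A = m"
    using M by (auto simp: A m_def dim_submatrix)
  have c: "cols B = take k (cols M)"
    using cols_submatrix_UNIV_lessThan[of k M] k M by (simp add: B_def)
  interpret W: vec_space "TYPE(complex)" m .
  have "mat_rank_rows S M k = W.rank A"
    unfolding mat_rank_rows_def Let_def A[symmetric] m by simp
  also have "\<dots> = vectorspace.dim class_ring ((Cvs m)\<lparr>carrier := W.span (set (cols A))\<rparr>)"
    unfolding W.rank_def by simp
  also have "W.span (set (cols A)) =
      (\<lambda>v. vec m (\<lambda>i. v $ pick ?I i)) ` flag_of_mat n M k"
    using span_cols_submatrix[OF B, of ?I]
    unfolding A_def[symmetric] c flag_of_mat_def m_def mem_Collect_eq .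
  finally show ?thesis .
qed

lemma flag_rank_eq:
  assumes M: "represents n M F" and k: "k \<le> n"
  shows "flag_rank n S F k = mat_rank_rows S M k"
proof -
  have N: "represents n (SOME N. represents n N F) F"
    using M by (rule someI)
  show ?thesis
    using mat_rank_rows_eq[of _ n k S] M N k by (simp add: flag_rank_def represents_def)
qed

subsection \<open>Tilted Richardson varieties\<close>

definition cyc_interval :: "nat \<Rightarrow> nat \<Rightarrow> nat \<Rightarrow> nat set"
  where "cyc_interval n a b = (if a \<le> b then {a..<b} else {a..n} \<union> {1..<b})"

definition tilted_richardson ::
    "nat \<Rightarrow> (nat \<Rightarrow> nat) \<Rightarrow> (nat \<Rightarrow> nat) \<Rightarrow> (nat \<Rightarrow> nat) \<Rightarrow> (nat \<Rightarrow> complex vec set) set"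
  where "tilted_richardson n u v a = {F. complete_flag n F \<and>
    (\<forall>i\<in>{1..n}. \<forall>k\<in>{1..n}.
      flag_rank n (cyc_interval n (a k) i) F k \<le> card (u ` {1..k} \<inter> cyc_interval n (a k) i) \<and>
      flag_rank n (cyc_interval n i (a k)) F k \<le> card (v ` {1..k} \<inter> cyc_interval n i (a k)))}"

definition open_tilted_richardson ::
    "nat \<Rightarrow> (nat \<Rightarrow> nat) \<Rightarrow> (nat \<Rightarrow> nat) \<Rightarrow> (nat \<Rightarrow> nat) \<Rightarrow> (nat \<Rightarrow> complex vec set) set"
  where "open_tilted_richardson n u v a = {F. complete_flag n F \<and>
    (\<forall>i\<in>{1..n}. \<forall>k\<in>{1..n}.
      flag_rank n (cyc_interval n (a k) i) F k = card (u ` {1..k} \<inter> cyc_interval n (a k) i) \<and>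
      flag_rank n (cyc_interval n i (a k)) F k = card (v ` {1..k} \<inter> cyc_interval n i (a k)))}"

subsection \<open>The shifted Gale order\<close>

text \<open>On \<open>[n]\<close>, \<open>cyc_less r\<close> is the order \<open>r < r + 1 < \<dots> < n < 1 < \<dots> < r - 1\<close>.\<close>

definition cyc_less :: "nat \<Rightarrow> nat \<Rightarrow> nat \<Rightarrow> bool"
  where "cyc_less r x y \<longleftrightarrow> r \<le> x \<and> x < y \<or> y < r \<and> r \<le> x \<or> x < y \<and> y < r"

definition gale_le :: "nat \<Rightarrow> nat set \<Rightarrow> nat set \<Rightarrow> bool"
  where "gale_le r A B \<longleftrightarrow>
    (\<exists>as bs. sorted_wrt (cyc_less r) as \<and> set as = A \<and>
             sorted_wrt (cyc_less r) bs \<and> set bs = B \<and>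
             list_all2 (\<lambda>x y. cyc_less r x y \<or> x = y) as bs)"

definition tilted_le :: "nat \<Rightarrow> (nat \<Rightarrow> nat) \<Rightarrow> (nat \<Rightarrow> nat) \<Rightarrow> (nat \<Rightarrow> nat) \<Rightarrow> bool"
  where "tilted_le n a u v \<longleftrightarrow> (\<forall>k\<in>{1..n}. gale_le (a k) (u ` {1..k}) (v ` {1..k}))"

subsection \<open>The quantum Bruhat graph and tilted Bruhat intervals\<close>

definition perm_length :: "nat \<Rightarrow> (nat \<Rightarrow> nat) \<Rightarrow> nat"
  where "perm_length n w = card {(i, j). 1 \<le> i \<and> i < j \<and> j \<le> n \<and> w j < w i}"

definition quantum_bruhat :: "nat \<Rightarrow> ((nat \<Rightarrow> nat) \<times> (nat \<Rightarrow> nat)) set"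
  where "quantum_bruhat n = {(w, x). w permutes {1..n} \<and>
    (\<exists>i j. 1 \<le> i \<and> i < j \<and> j \<le> n \<and> x = w \<circ> Transposition.transpose i j \<and>
      (int (perm_length n x) = int (perm_length n w) + 1 \<or>
       int (perm_length n x) = int (perm_length n w) + 1 - 2 * (int j - int i)))}"

definition qb_dist :: "nat \<Rightarrow> (nat \<Rightarrow> nat) \<Rightarrow> (nat \<Rightarrow> nat) \<Rightarrow> enat"
  where "qb_dist n x y = (INF m\<in>{m. (x, y) \<in> quantum_bruhat n ^^ m}. enat m)"

definition tilted_interval :: "nat \<Rightarrow> (nat \<Rightarrow> nat) \<Rightarrow> (nat \<Rightarrow> nat) \<Rightarrow> (nat \<Rightarrow> nat) set"
  where "tilted_interval n u v =
    {w. w permutes {1..n} \<and> qb_dist n u w + qb_dist n w v = qb_dist n u v}"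

end

theory Submission
  imports Defs
begin

text \<open>
  If \<open>F\<close> lies in the variety, the ranks of \<open>F\<^sub>k\<close> on two complementary cyclic intervals add up to at least
  \<open>k\<close>; comparing the two rank bounds gives \<open>u \<le>\<^sub>a v\<close>.  A torus-fixed flag consists of coordinate
  subspaces, so it is some \<open>e\<^sub>w\<close>, whose ranks are cardinalities of intersections; hence \<open>e\<^sub>w\<close> lies in
  the variety iff \<open>u \<le>\<^sub>a w \<le>\<^sub>a v\<close>.

  To compare this with the tilted interval, put
  \<open>d\<^sub>k(x, y) = max\<^sub>i (|y[k] \<inter> [1, i)| - |x[k] \<inter> [1, i)|)\<close>.  Then
  \<open>\<ell>(x, y) = \<ell>(y) - \<ell>(x) + 2 (d\<^sub>1(x, y) + \<dots> + d\<^sub>n(x, y))\<close>: the right-hand side satisfies the triangle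
  inequality and is at most \<open>1\<close> on every edge, and some edge starting at \<open>x\<close> always lowers it by \<open>1\<close>.
  So \<open>w\<close> lies in the tilted interval iff \<open>d\<^sub>k(u, w) + d\<^sub>k(w, v) = d\<^sub>k(u, v)\<close> for all \<open>k\<close>.  Since
  \<open>x \<le>\<^sub>a y\<close> means that the maximum defining \<open>d\<^sub>k(x, y)\<close> is attained at \<open>i = a\<^sub>k\<close>, this is again
  \<open>u \<le>\<^sub>a w \<le>\<^sub>a v\<close> once \<open>u \<le>\<^sub>a v\<close>.
\<close>

subsection \<open>Dimensions of subspaces\<close>

text \<open>Independent subsets of \<open>W\<close> are independent in \<open>V\<close>, so
  \<open>dim\<close> bounds their size; a maximal one exists, is finite and is a basis of
  \<open>W\<close>.\<close>

lemma (in vectorspace) subspace_fin_dim: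
  assumes fd: "fin_dim" and W: "VectorSpace.subspace K W V"
  shows "vectorspace.fin_dim K (vs W)"
proof -
  interpret W: vectorspace K "vs W"
    using W by (rule subspace_is_vs)
  have sm: "submodule K W V"
    using W by simp
  have WV: "W \<subseteq> carrier V"
    using sm by (simp add: submodule_def)
  have li: "finite A \<and> card A \<le> dim" if "A \<subseteq> carrier (vs W) \<and> W.lin_indpt A" for A
  proof -
    have "lin_indpt A"
      using that span_li_not_depend(2)[OF _ sm, of A] by simp
    then show ?thesis
      using li_le_dim[OF fd, of A] that WV by auto
  qed
  have "W.lin_indpt {}"
    unfolding W.lin_dep_def by simp
  then obtain A where A: "finite A" "maximal A (\<lambda>S. S \<subseteq> carrier (vs W) \<and> W.lin_indpt S)"
    using maximal_exists[of "\<lambda>S. S \<subseteq> carrier (vs W) \<and> W.lin_indpt S" dim "{}"] li by auto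
  then have "W.basis A"
    using W.max_li_is_basis by blast
  then show ?thesis
    using A(1) unfolding W.fin_dim_def W.basis_def by auto
qed

lemma (in vectorspace) subspace_dim_mono:
  assumes fd: "fin_dim" and W: "VectorSpace.subspace K W V" and X: "VectorSpace.subspace K X V" and "X \<subseteq> W"
  shows "vectorspace.dim K (vs X) \<le> vectorspace.dim K (vs W)"
proof -
  interpret W: vectorspace K "vs W"
    using W by (rule subspace_is_vs)
  have "VectorSpace.subspace K X (vs W)"
    using nested_subspaces[OF W X] assms by simp
  then show ?thesis
    using W.subspace_dim[of X] subspace_fin_dim[OF fd W] subspace_fin_dim[OF fd X] by simp
qed

text \<open>A basis of \<open>X\<close> is independent in \<open>W\<close> and has as many elements
  as a basis of \<open>W\<close>, so it spans both.\<close>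

lemma (in vectorspace) subspace_dim_eq_imp_eq:
  assumes fd: "fin_dim" and W: "VectorSpace.subspace K W V" and X: "VectorSpace.subspace K X V" and "X \<subseteq> W"
    and dim: "vectorspace.dim K (vs X) = vectorspace.dim K (vs W)"
  shows "X = W"
proof -
  interpret W: vectorspace K "vs W"
    using W by (rule subspace_is_vs)
  interpret X: vectorspace K "vs X"
    using X by (rule subspace_is_vs)
  have sm: "submodule K X V" "submodule K W V"
    using W X by simp_all
  obtain b where b: "finite b" "X.basis b"
    using X.finite_basis_exists subspace_fin_dim[OF fd X] by blast
  have bX: "b \<subseteq> X" "X.span b = X" "X.lin_indpt b"
    using b(2) unfolding X.basis_def by auto
  have "W.lin_indpt b"
    using bX span_li_not_depend(2)[OF _ sm(1), of b] span_li_not_depend(2)[OF _ sm(2), of b] assms(4) by auto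
  then have "W.basis b"
    using W.dim_li_is_basis[of b] subspace_fin_dim[OF fd W] b bX assms(4) dim X.dim_basis[of b] by auto
  then have "W.span b = W"
    unfolding W.basis_def by simp
  then show ?thesis
    using bX span_li_not_depend(1)[OF _ sm(1), of b] span_li_not_depend(1)[OF _ sm(2), of b] assms(4) by auto
qed

text \<open>The second map is injective on the kernel of the first one.\<close>

lemma dim_le_sum_of_images:
  assumes T: "linear_map K V W T" and U: "linear_map K V X U"
    and fd: "vectorspace.fin_dim K V" "vectorspace.fin_dim K X"
    and inj: "\<And>v. v \<in> carrier V \<Longrightarrow> T v = \<zero>\<^bsub>W\<^esub> \<Longrightarrow> U v = \<zero>\<^bsub>X\<^esub> \<Longrightarrow> v = \<zero>\<^bsub>V\<^esub>"
  shows "vectorspace.dim K V \<le> vectorspace.dim K (W\<lparr>carrier := T ` carrier V\<rparr>) +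
    vectorspace.dim K (X\<lparr>carrier := U ` carrier V\<rparr>)"
proof -
  interpret T: linear_map K V W T by fact
  interpret U: linear_map K V X U by fact
  let ?N = "V\<lparr>carrier := T.kerT\<rparr>"
  have ker: "VectorSpace.subspace K T.kerT V"
    by (rule T.kerT_is_subspace)
  interpret N: vectorspace K ?N
    using ker by (rule T.V.subspace_is_vs)
  have "U \<in> LinearCombinations.module_hom K ?N X"
    using U.f_hom by (auto simp: LinearCombinations.module_hom_def T.ker_def)
  then interpret R: linear_map K ?N X U
    by (intro linear_map.intro mod_hom.intro mod_hom_axioms.intro N.vectorspace_axioms
        U.W.vectorspace_axioms vectorspace.axioms(1)[OF N.vectorspace_axioms]
        vectorspace.axioms(1)[OF U.W.vectorspace_axioms])
  have N_fd: "N.fin_dim"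
    using T.V.subspace_fin_dim ker fd by blast
  have "R.kerT \<subseteq> {\<zero>\<^bsub>V\<^esub>}"
    using inj unfolding R.ker_def by (auto simp: T.ker_def)
  moreover have "\<zero>\<^bsub>V\<^esub> \<in> R.kerT"
    unfolding R.ker_def by (auto simp: T.ker_def)
  ultimately have "R.kerT = {\<zero>\<^bsub>V\<^esub>}"
    by blast
  then have "inj_on U (carrier ?N)"
    using R.Ke0_imp_inj by simp
  then have "vectorspace.dim K (?N\<lparr>carrier := R.kerT\<rparr>) = 0"
    by (rule R.inj_imp_dim_ker0)
  \<comment> \<open>Injectivity turns the nullity of \<open>T\<close> into the dimension of the
    image under \<open>U\<close> of the kernel of \<open>T\<close>, a subspace of the full image of
    \<open>U\<close>; rank-nullity for \<open>T\<close> then gives the bound.\<close>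
  then have "N.dim = vectorspace.dim K (X\<lparr>carrier := R.imT\<rparr>)"
    using R.rank_nullity[OF N_fd] by simp
  also have "\<dots> \<le> vectorspace.dim K (X\<lparr>carrier := U.imT\<rparr>)"
    by (rule U.W.subspace_dim_mono[OF fd(2) U.imT_is_subspace R.imT_is_subspace])
      (unfold R.im_def U.im_def, auto simp: T.ker_def)
  finally show ?thesis
    using T.rank_nullity[OF fd(1)] by (simp add: T.im_def U.im_def)
qed

section \<open>Subspaces of complex n-space\<close>

abbreviation Csub :: "nat \<Rightarrow> complex vec set \<Rightarrow> bool"
  where "Csub n W \<equiv> VectorSpace.subspace class_ring W (Cvs n)"

abbreviation Cdim :: "nat \<Rightarrow> complex vec set \<Rightarrow> nat"
  where "Cdim n W \<equiv> vectorspace.dim class_ring ((Cvs n)\<lparr>carrier := W\<rparr>)"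

lemma Csub_iff:
  "Csub n W \<longleftrightarrow> W \<subseteq> carrier_vec n \<and> 0\<^sub>v n \<in> W \<and> (\<forall>v\<in>W. \<forall>w\<in>W. v + w \<in> W) \<and>
    (\<forall>c. \<forall>v\<in>W. c \<cdot>\<^sub>v v \<in> W)"
  unfolding VectorSpace.subspace_def submodule_def
  by (auto simp: vec_vs vec_module module_vec_simps class_ring_simps)

lemma Cdim_mono: "Csub n W \<Longrightarrow> Csub n X \<Longrightarrow> X \<subseteq> W \<Longrightarrow> Cdim n X \<le> Cdim n W"
proof -
  interpret V: vec_space "TYPE(complex)" n .
  show "Csub n W \<Longrightarrow> Csub n X \<Longrightarrow> X \<subseteq> W \<Longrightarrow> Cdim n X \<le> Cdim n W"
    by (rule V.subspace_dim_mono[OF V.fin_dim])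
qed

lemma Cdim_eq_imp_eq: "Csub n W \<Longrightarrow> Csub n X \<Longrightarrow> X \<subseteq> W \<Longrightarrow> Cdim n X = Cdim n W \<Longrightarrow> X = W"
proof -
  interpret V: vec_space "TYPE(complex)" n .
  show "Csub n W \<Longrightarrow> Csub n X \<Longrightarrow> X \<subseteq> W \<Longrightarrow> Cdim n X = Cdim n W \<Longrightarrow> X = W"
    by (rule V.subspace_dim_eq_imp_eq[OF V.fin_dim])
qed

lemma Csub_span:
  "S \<subseteq> carrier_vec n \<Longrightarrow> Csub n (LinearCombinations.module.span class_ring (Cvs n) S)"
proof -
  interpret V: vec_space "TYPE(complex)" n .
  show "S \<subseteq> carrier_vec n \<Longrightarrow> Csub n (V.span S)"
    by (rule V.span_is_subspace)
qed

lemma span_subset_Csub: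
  assumes "Csub n W" and "S \<subseteq> W"
  shows "LinearCombinations.module.span class_ring (Cvs n) S \<subseteq> W"
proof -
  interpret V: vec_space "TYPE(complex)" n .
  show "V.span S \<subseteq> W"
    using assms by (intro V.span_is_subset) auto
qed

lemma in_own_span_Cvs:
  "S \<subseteq> carrier_vec n \<Longrightarrow> S \<subseteq> LinearCombinations.module.span class_ring (Cvs n) S"
proof -
  interpret V: vec_space "TYPE(complex)" n .
  show "S \<subseteq> carrier_vec n \<Longrightarrow> S \<subseteq> V.span S"
    by (rule V.in_own_span)
qed

lemma Cdim_carrier: "Cdim n (carrier_vec n) = n"
proof -
  interpret V: vec_space "TYPE(complex)" n .
  have "(Cvs n)\<lparr>carrier := carrier_vec n\<rparr> = Cvs n"
    by (simp add: module_vec_def)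
  then show ?thesis
    using V.dim_is_n by (simp only:)
qed

lemma Cdim_zero: "Cdim n {0\<^sub>v n} = 0"
proof -
  interpret V: vec_space "TYPE(complex)" n .
  show ?thesis
    using V.dim_zero_vs V.span_empty by simp
qed

subsection \<open>Coordinate subspaces and permutation flags\<close>

text \<open>The span of the standard basis vectors with numbers in \<open>A\<close>. Members of
  \<open>A\<close> count from 1 and vector entries from 0; elements of \<open>A\<close> outside
  \<open>{1..n}\<close> have no effect.\<close>

definition coord_space :: "nat \<Rightarrow> nat set \<Rightarrow> complex vec set"
  where "coord_space n A = {v \<in> carrier_vec n. \<forall>i<n. v $ i \<noteq> 0 \<longrightarrow> Suc i \<in> A}"

lemma Csub_coord_space: "Csub n (coord_space n A)"
  unfolding Csub_iff coord_space_def by auto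

text \<open>Induction on the number of non-zero entries of \<open>v\<close>: clear one entry, and
  add it back as a multiple of a unit vector in \<open>W\<close>.\<close>

lemma coord_space_subset:
  assumes W: "Csub n W" and e: "\<And>i. i < n \<Longrightarrow> Suc i \<in> A \<Longrightarrow> unit_vec n i \<in> W"
  shows "coord_space n A \<subseteq> W"
proof
  fix v assume "v \<in> coord_space n A"
  then show "v \<in> W"
  proof (induction "card {i. i < n \<and> v $ i \<noteq> 0}" arbitrary: v rule: less_induct)
    case less
    then have v: "v \<in> carrier_vec n" "\<And>i. i < n \<Longrightarrow> v $ i \<noteq> 0 \<Longrightarrow> Suc i \<in> A"
      by (auto simp: coord_space_def)
    show ?case
    proof (cases "\<exists>i<n. v $ i \<noteq> 0")
      case False
      then have "v = 0\<^sub>v n"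
        using v by (intro eq_vecI) auto
      then show ?thesis
        using W by (simp add: Csub_iff)
    next
      case True
      then obtain i where i: "i < n" "v $ i \<noteq> 0"
        by blast
      define x where "x = vec n (\<lambda>j. if j = i then 0 else v $ j)"
      have "{j. j < n \<and> x $ j \<noteq> 0} \<subset> {j. j < n \<and> v $ j \<noteq> 0}"
      proof (rule psubsetI)
        show "{j. j < n \<and> x $ j \<noteq> 0} \<subseteq> {j. j < n \<and> v $ j \<noteq> 0}"
          by (auto simp: x_def split: if_splits)
        have "i \<notin> {j. j < n \<and> x $ j \<noteq> 0}" "i \<in> {j. j < n \<and> v $ j \<noteq> 0}"
          using i by (simp_all add: x_def)
        then show "{j. j < n \<and> x $ j \<noteq> 0} \<noteq> {j. j < n \<and> v $ j \<noteq> 0}"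
          by blast
      qed
      then have "card {j. j < n \<and> x $ j \<noteq> 0} < card {j. j < n \<and> v $ j \<noteq> 0}"
        by (intro psubset_card_mono) auto
      moreover have "x \<in> coord_space n A"
        using v by (auto simp: coord_space_def x_def)
      ultimately have "x \<in> W"
        using less.hyps by blast
      moreover have "v $ i \<cdot>\<^sub>v unit_vec n i \<in> W"
        using W e[OF i(1) v(2)[OF i]] by (simp add: Csub_iff)
      moreover have "v = x + v $ i \<cdot>\<^sub>v unit_vec n i"
        using v(1) i(1) by (intro eq_vecI) (auto simp: x_def)
      ultimately show ?thesis
        using W unfolding Csub_iff by metis
    qed
  qed
qed

lemma unit_vec_in_coord_space: "i < n \<Longrightarrow> unit_vec n i \<in> coord_space n A \<longleftrightarrow> Suc i \<in> A"
  by (auto simp: coord_space_def)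

lemma span_unit_vecs:
  "LinearCombinations.module.span class_ring (Cvs n) (unit_vec n ` {i. i < n \<and> Suc i \<in> A}) =
    coord_space n A"
proof
  show "LinearCombinations.module.span class_ring (Cvs n) (unit_vec n ` {i. i < n \<and> Suc i \<in> A}) \<subseteq>
      coord_space n A"
    by (rule span_subset_Csub[OF Csub_coord_space]) (auto simp: unit_vec_in_coord_space)
  have "unit_vec n ` {i. i < n \<and> Suc i \<in> A} \<subseteq> carrier_vec n"
    by auto
  then show "coord_space n A \<subseteq>
      LinearCombinations.module.span class_ring (Cvs n) (unit_vec n ` {i. i < n \<and> Suc i \<in> A})"
    using in_own_span_Cvs by (intro coord_space_subset Csub_span) blast+
qed

lemma Cdim_coord_space: "Cdim n (coord_space n A) = card (A \<inter> {1..n})"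
proof -
  interpret V: vec_space "TYPE(complex)" n .
  let ?I = "{i. i < n \<and> Suc i \<in> A}"
  let ?U = "unit_vec n ` ?I :: complex vec set"
  have "V.lin_indpt (set (unit_vecs n))"
    using V.unit_vecs_basis unfolding V.basis_def by blast
  moreover have "?U \<subseteq> set (unit_vecs n)"
    by (auto simp: unit_vecs_def)
  ultimately have "V.lin_indpt ?U"
    by (rule V.subset_li_is_li)
  \<comment> \<open>Being independent, \<open>?U\<close> is its own maximal independent subset, so
    its size is the dimension of its span.\<close>
  then have "maximal ?U (\<lambda>T. T \<subseteq> ?U \<and> V.lin_indpt T)"
    by (auto simp: maximal_def)
  then have "vectorspace.dim class_ring (V.span_vs ?U) = card ?U"
    by (intro V.dim_span) auto
  also have "card ?U = card ?I"
    by (intro card_image inj_onI) (metis (mono_tags, lifting) index_unit_vec(1) mem_Collect_eq zero_neq_one)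
  also have "\<dots> = card (Suc ` ?I)"
    by (simp add: card_image)
  also have "Suc ` ?I = A \<inter> {1..n}"
    by (auto simp: image_iff) (metis Suc_le_D Suc_le_lessD)
  finally show ?thesis
    by (simp add: span_unit_vecs)
qed

section \<open>Permutation matrices and their flags\<close>

definition perm_mat :: "nat \<Rightarrow> (nat \<Rightarrow> nat) \<Rightarrow> complex mat"
  where "perm_mat n w = mat n n (\<lambda>(i, j). if Suc i = w (Suc j) then 1 else 0)"

lemma perm_mat_carrier [simp]: "perm_mat n w \<in> carrier_mat n n"
  by (simp add: perm_mat_def)

text \<open>The column with number \<open>r\<close> of the permutation matrix is the unit vector
  with number \<open>w r\<close>. The \<open>min\<close> reflects that \<open>take k\<close> returns
  all \<open>n\<close> columns once \<open>k\<close> exceeds \<open>n\<close>.\<close>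

lemma perm_flag_eq_coord_space:
  assumes w: "w permutes {1..n}"
  shows "perm_flag n w k = coord_space n (w ` {1..min k n})"
proof -
  have win: "w r \<in> {1..n} \<longleftrightarrow> r \<in> {1..n}" for r
    using permutes_in_image[OF w] by blast
  have col: "col (perm_mat n w) j = unit_vec n (w (Suc j) - 1)" if "j < n" for j
    using that win[of "Suc j"] by (intro eq_vecI) (auto simp: perm_mat_def)
  have "set (take k (cols (perm_mat n w))) = (\<lambda>j. col (perm_mat n w) j) ` {..<min k n}"
    unfolding cols_def by (auto simp: take_map perm_mat_def min_def)
  also have "\<dots> = (\<lambda>j. unit_vec n (w (Suc j) - 1)) ` {..<min k n}"
    using col by (intro image_cong) auto
  also have "\<dots> = unit_vec n ` (\<lambda>r. w r - 1) ` Suc ` {..<min k n}"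
    by (simp add: image_image)
  also have "Suc ` {..<min k n} = {1..min k n}"
    by (simp add: lessThan_atLeast0 atLeastLessThanSuc_atLeastAtMost image_Suc_atLeastLessThan)
  also have "(\<lambda>r. w r - 1) ` {1..min k n} = {i. i < n \<and> Suc i \<in> w ` {1..min k n}}"
  proof (intro equalityI subsetI)
    fix i assume "i \<in> (\<lambda>r. w r - 1) ` {1..min k n}"
    then obtain r where r: "r \<in> {1..min k n}" "i = w r - 1"
      by blast
    moreover have "w r \<in> {1..n}"
      using win[of r] r by simp
    ultimately show "i \<in> {i. i < n \<and> Suc i \<in> w ` {1..min k n}}"
      by (auto intro!: image_eqI[of _ _ r])
  next
    fix i assume "i \<in> {i. i < n \<and> Suc i \<in> w ` {1..min k n}}"
    then obtain r where "r \<in> {1..min k n}" "Suc i = w r"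
      by blast
    then show "i \<in> (\<lambda>r. w r - 1) ` {1..min k n}"
      by (auto intro!: image_eqI[of _ _ r])
  qed
  finally show ?thesis
    unfolding perm_flag_def flag_of_mat_def perm_mat_def[symmetric] by (simp add: span_unit_vecs)
qed

lemma card_permutes_image:
  assumes "w permutes A"
  shows "card (w ` B) = card B"
  using card_image[OF inj_on_subset[OF permutes_inj[OF assms] subset_UNIV], of B] .

lemma permutes_image_subset:
  fixes n :: nat
  assumes "w permutes {1..n}" and "k \<le> n"
  shows "w ` {1..k} \<subseteq> {1..n}"
proof -
  have "w ` {1..k} \<subseteq> w ` {1..n}"
    using assms(2) by (intro image_mono) auto
  then show ?thesis
    using permutes_image[OF assms(1)] by simp
qed

lemma complete_flag_perm_flag:
  assumes w: "w permutes {1..n}"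
  shows "complete_flag n (perm_flag n w)"
  unfolding complete_flag_def
proof (intro allI conjI)
  fix k
  show "Csub n (perm_flag n w k)"
    unfolding perm_flag_eq_coord_space[OF w] by (rule Csub_coord_space)
  have "w ` {1..min k n} \<inter> {1..n} = w ` {1..min k n}"
    using permutes_image_subset[OF w, of "min k n"] by auto
  then show "Cdim n (perm_flag n w k) = min k n"
    unfolding perm_flag_eq_coord_space[OF w] Cdim_coord_space by (simp add: card_permutes_image[OF w])
  have "w ` {1..min k n} \<subseteq> w ` {1..min (Suc k) n}"
    by (intro image_mono) auto
  then show "perm_flag n w k \<subseteq> perm_flag n w (Suc k)"
    unfolding perm_flag_eq_coord_space[OF w] by (auto simp: coord_space_def)
qed

lemma invertible_mat_if_span:
  assumes M: "M \<in> carrier_mat n n"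
    and span: "LinearCombinations.module.span class_ring (Cvs n) (set (cols M)) = carrier_vec n"
  shows "invertible_mat (M :: complex mat)"
proof -
  interpret V: vec_space "TYPE(complex)" n .
  have "V.rank M = n"
    unfolding V.rank_def span by (rule Cdim_carrier)
  then have "det M \<noteq> 0"
    using V.det_rank_iff[OF M] by simp
  then obtain B where "B \<in> carrier_mat n n" "B * M = 1\<^sub>m n" "M * B = 1\<^sub>m n"
    using det_non_zero_imp_unit[OF M] unfolding Units_def ring_mat_def by auto
  then show ?thesis
    using M unfolding invertible_mat_def inverts_mat_def by auto
qed

lemma coord_space_full: "{1..n} \<subseteq> A \<Longrightarrow> coord_space n A = carrier_vec n"
  by (auto simp: coord_space_def)

lemma represents_perm_flag:
  assumes w: "w permutes {1..n}"
  shows "represents n (perm_mat n w) (perm_flag n w)"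
proof -
  have "flag_of_mat n (perm_mat n w) n = coord_space n (w ` {1..n})"
    using perm_flag_eq_coord_space[OF w, of n] by (simp add: perm_flag_def perm_mat_def)
  then have "LinearCombinations.module.span class_ring (Cvs n) (set (cols (perm_mat n w))) = carrier_vec n"
    using permutes_image[OF w] by (simp add: flag_of_mat_def coord_space_full perm_mat_def)
  then show ?thesis
    unfolding represents_def using invertible_mat_if_span[OF perm_mat_carrier]
    by (simp add: perm_flag_def perm_mat_def)
qed

text \<open>Restricting to the rows in \<open>S\<close> is a coordinate projection, and the rank is
  the dimension of the image of \<open>F k\<close>. The representative drops out of the right-hand
  side, so ranks can be computed from subspaces alone.\<close>

lemma flag_rank_eq_Cdim:
  fixes S :: "nat set"
  assumes "represents n M F" and "k \<le> n"
  defines "m \<equiv> card {i. i < n \<and> Suc i \<in> S}"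
  shows "flag_rank n S F k = Cdim m ((\<lambda>v. vec m (\<lambda>i. v $ pick {i. Suc i \<in> S} i)) ` F k)"
  using flag_rank_eq[OF assms(1,2)] mat_rank_rows_eq[OF _ assms(2), of M S] assms(1)
  by (simp add: represents_def m_def)

text \<open>Projecting a coordinate subspace to the rows in \<open>S\<close> gives again a
  coordinate subspace, with the rows renumbered by \<open>pick\<close>; its dimension counts the
  rows that survive.\<close>

lemma flag_rank_perm_flag:
  assumes w: "w permutes {1..n}" and k: "k \<le> n" and S: "S \<subseteq> {1..n}"
  shows "flag_rank n S (perm_flag n w) k = card (w ` {1..k} \<inter> S)"
proof -
  let ?I = "{i. Suc i \<in> S}"
  let ?A = "w ` {1..k}"
  define m where "m = card {i. i < n \<and> Suc i \<in> S}"
  have I: "{i. i < n \<and> Suc i \<in> S} = ?I" "?I \<subseteq> {..<n}"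
    using S by auto
  \<comment> \<open>\<open>pick ?I\<close> lists \<open>?I\<close> increasingly; its inverse sends
    \<open>i\<close> to the number of elements of \<open>?I\<close> below \<open>i\<close>.\<close>
  have pick: "pick ?I j \<in> ?I" "card {a \<in> ?I. a < pick ?I j} = j" if "j < m" for j
    using that pick_in_set_le[of j ?I] card_pick_le[of j ?I] by (simp_all add: m_def I)
  have inv: "card {a \<in> ?I. a < i} < m" "pick ?I (card {a \<in> ?I. a < i}) = i" if "i \<in> ?I" for i
  proof -
    show "pick ?I (card {a \<in> ?I. a < i}) = i"
      using that by (rule pick_card_in_set)
    have "{a \<in> ?I. a < i} \<subset> ?I"
      using that by auto
    then show "card {a \<in> ?I. a < i} < m"
      unfolding m_def I using finite_subset[OF I(2)] by (intro psubset_card_mono) auto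
  qed
  \<comment> \<open>The new numbers, counted from 1, of the rows in \<open>S\<close> that belong to
    \<open>w[k]\<close>.\<close>
  define B where "B = {j \<in> {1..m}. Suc (pick ?I (j - 1)) \<in> ?A}"
  have "(\<lambda>v. vec m (\<lambda>i. v $ pick ?I i)) ` coord_space n ?A = coord_space m B"
  proof (intro equalityI subsetI)
    fix y assume "y \<in> (\<lambda>v. vec m (\<lambda>i. v $ pick ?I i)) ` coord_space n ?A"
    then obtain v where v: "v \<in> coord_space n ?A" "y = vec m (\<lambda>i. v $ pick ?I i)"
      by blast
    have "Suc i \<in> B" if "i < m" "y $ i \<noteq> 0" for i
      using v that pick(1)[OF that(1)] I(2) by (auto simp: coord_space_def B_def)
    then show "y \<in> coord_space m B"
      using v by (auto simp: coord_space_def)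
  next
    fix y assume y: "y \<in> coord_space m B"
    \<comment> \<open>The lift of \<open>y\<close> that vanishes on all rows outside
      \<open>S\<close>.\<close>
    define v where "v = vec n (\<lambda>l. if l \<in> ?I then y $ card {a \<in> ?I. a < l} else 0)"
    have "Suc l \<in> ?A" if "l < n" "v $ l \<noteq> 0" for l
    proof -
      have l: "l \<in> ?I" "y $ card {a \<in> ?I. a < l} \<noteq> 0"
        using that by (auto simp: v_def split: if_splits)
      then have "Suc (card {a \<in> ?I. a < l}) \<in> B"
        using y inv(1)[OF l(1)] unfolding coord_space_def by blast
      then show ?thesis
        using inv(2)[OF l(1)] by (auto simp: B_def)
    qed
    then have "v \<in> coord_space n ?A"
      by (auto simp: coord_space_def v_def)
    moreover have "y = vec m (\<lambda>i. v $ pick ?I i)"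
    proof (rule eq_vecI)
      fix i assume "i < dim_vec (vec m (\<lambda>i. v $ pick ?I i))"
      then have i: "i < m"
        by simp
      then have "pick ?I i < n" "pick ?I i \<in> ?I"
        using pick(1)[OF i] I(2) by auto
      then show "y $ i = vec m (\<lambda>i. v $ pick ?I i) $ i"
        using pick(2)[OF i] i by (simp add: v_def)
    qed (use y in \<open>auto simp: coord_space_def\<close>)
    ultimately show "y \<in> (\<lambda>v. vec m (\<lambda>i. v $ pick ?I i)) ` coord_space n ?A"
      by blast
  qed
  moreover have "perm_flag n w k = coord_space n ?A"
    using perm_flag_eq_coord_space[OF w, of k] k by (simp add: min_def)
  ultimately have "flag_rank n S (perm_flag n w) k = card (B \<inter> {1..m})"
    using flag_rank_eq_Cdim[OF represents_perm_flag[OF w] k, of S]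
    by (simp add: m_def[symmetric] Cdim_coord_space)
  also have "B \<inter> {1..m} = B"
    by (auto simp: B_def)
  also have "card B = card (?A \<inter> S)"
  proof (rule bij_betw_same_card, rule bij_betw_imageI)
    show "inj_on (\<lambda>j. Suc (pick ?I (j - 1))) B"
    proof (rule inj_onI)
      fix j l assume jl: "j \<in> B" "l \<in> B" and eq: "Suc (pick ?I (j - 1)) = Suc (pick ?I (l - 1))"
      have "j - 1 < m" "l - 1 < m" "j \<ge> 1" "l \<ge> 1"
        using jl by (simp_all add: B_def) linarith+
      moreover have "j - 1 = l - 1"
        using pick(2)[OF \<open>j - 1 < m\<close>] pick(2)[OF \<open>l - 1 < m\<close>] eq by (metis Suc_inject)
      ultimately show "j = l"
        by linarith
    qed
    show "(\<lambda>j. Suc (pick ?I (j - 1))) ` B = ?A \<inter> S"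
    proof (intro equalityI subsetI)
      fix z assume "z \<in> (\<lambda>j. Suc (pick ?I (j - 1))) ` B"
      then obtain j where j: "j \<in> B" "z = Suc (pick ?I (j - 1))"
        by blast
      then have "j - 1 < m" and "Suc (pick ?I (j - 1)) \<in> ?A"
        unfolding B_def by (fastforce, blast)
      then show "z \<in> ?A \<inter> S"
        using j(2) pick(1)[of "j - 1"] by simp
    next
      fix z assume z: "z \<in> ?A \<inter> S"
      then have "z \<noteq> 0"
        using S by auto
      then obtain i where i: "z = Suc i"
        using not0_implies_Suc by blast
      then have iI: "i \<in> ?I"
        using z by simp
      let ?j = "Suc (card {a \<in> ?I. a < i})"
      have "?j \<in> B"
        unfolding B_def using inv[OF iI] z i by simp
      moreover have "z = Suc (pick ?I (?j - 1))"
        using inv(2)[OF iI] i by simp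
      ultimately show "z \<in> (\<lambda>j. Suc (pick ?I (j - 1))) ` B"
        by (rule rev_image_eqI)
    qed
  qed
  finally show ?thesis .
qed

subsection \<open>Torus-fixed flags\<close>

lemma diagonal_mult_vec:
  assumes "D \<in> carrier_mat n n" and "diagonal_mat D" and "v \<in> carrier_vec n" and "i < n"
  shows "(D *\<^sub>v v) $ i = D $$ (i, i) * v $ i"
proof -
  have "(D *\<^sub>v v) $ i = (\<Sum>j = 0..<n. D $$ (i, j) * v $ j)"
    using assms by (simp add: scalar_prod_def)
  also have "\<dots> = (\<Sum>j = 0..<n. if j = i then D $$ (i, i) * v $ i else 0)"
    using assms by (intro sum.cong) (auto simp: diagonal_mat_def)
  finally show ?thesis
    using assms(4) by simp
qed

section \<open>Torus elements and their action on coordinate subspaces\<close>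

definition diag_of :: "nat \<Rightarrow> (nat \<Rightarrow> complex) \<Rightarrow> complex mat"
  where "diag_of n f = mat n n (\<lambda>(i, j). if i = j then f i else 0)"

lemma diag_of_simps [simp]:
  "diag_of n f \<in> carrier_mat n n" "diagonal_mat (diag_of n f)"
  "i < n \<Longrightarrow> diag_of n f $$ (i, i) = f i"
  "dim_row (diag_of n f) = n" "dim_col (diag_of n f) = n"
  by (auto simp: diag_of_def diagonal_mat_def)

lemma diag_of_mult: "diag_of n f * diag_of n g = diag_of n (\<lambda>i. f i * g i)"
proof (rule eq_matI)
  fix i j assume "i < dim_row (diag_of n (\<lambda>i. f i * g i))" "j < dim_col (diag_of n (\<lambda>i. f i * g i))"
  then have ij: "i < n" "j < n"
    by simp_all
  have "(diag_of n f * diag_of n g) $$ (i, j) = (diag_of n f *\<^sub>v col (diag_of n g) j) $ i"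
    using ij by simp
  also have "\<dots> = f i * diag_of n g $$ (i, j)"
    using ij diagonal_mult_vec[of "diag_of n f" n "col (diag_of n g) j" i] by simp
  finally show "(diag_of n f * diag_of n g) $$ (i, j) = diag_of n (\<lambda>i. f i * g i) $$ (i, j)"
    using ij by (simp add: diag_of_def)
qed simp_all

lemma diag_of_in_torus:
  assumes "\<And>i. f i \<noteq> 0"
  shows "diag_of n f \<in> torus n"
proof -
  have "diag_of n (\<lambda>i. 1) = 1\<^sub>m n"
    by (auto simp: diag_of_def)
  then have "inverts_mat (diag_of n f) (diag_of n (\<lambda>i. inverse (f i)))"
    "inverts_mat (diag_of n (\<lambda>i. inverse (f i))) (diag_of n f)"
    using assms unfolding inverts_mat_def by (simp_all add: diag_of_mult)
  then show ?thesis
    unfolding torus_def invertible_mat_def by auto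
qed

text \<open>A zero diagonal entry would make entry \<open>i\<close> of every vector in the image of
  \<open>D\<close> vanish, but the image contains the unit vector
  \<open>unit_vec n i\<close>.\<close>

lemma torus_diagonal_nonzero:
  assumes D: "D \<in> torus n" and i: "i < n"
  shows "D $$ (i, i) \<noteq> 0"
proof -
  have c: "D \<in> carrier_mat n n" "diagonal_mat D"
    using D by (auto simp: torus_def)
  obtain B where B: "D * B = 1\<^sub>m n" "B * D = 1\<^sub>m (dim_row B)"
    using D c by (auto simp: torus_def invertible_mat_def inverts_mat_def)
  \<comment> \<open>\<open>invertible_mat\<close> does not prescribe the shape of the inverse; it
    follows by comparing dimensions in the two product equations.\<close>
  have "dim_col (D * B) = n" "dim_col (B * D) = dim_row B"
    using B by simp_all
  then have Bc: "B \<in> carrier_mat n n"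
    using c by (intro carrier_matI) simp_all
  have "(D *\<^sub>v (B *\<^sub>v unit_vec n i)) $ i = 1"
    using i B(1) assoc_mult_mat_vec[OF c(1) Bc, of "unit_vec n i"] by simp
  then show ?thesis
    using diagonal_mult_vec[OF c, of "B *\<^sub>v unit_vec n i" i] Bc i by auto
qed

lemma torus_image_coord_space:
  assumes D: "D \<in> torus n"
  shows "(\<lambda>v. D *\<^sub>v v) ` coord_space n A = coord_space n A"
proof -
  have c: "D \<in> carrier_mat n n" "diagonal_mat D"
    using D by (auto simp: torus_def)
  show ?thesis
  proof (intro equalityI subsetI)
    fix y assume "y \<in> (\<lambda>v. D *\<^sub>v v) ` coord_space n A"
    then obtain v where v: "v \<in> carrier_vec n" "\<forall>i<n. v $ i \<noteq> 0 \<longrightarrow> Suc i \<in> A" and y: "y = D *\<^sub>v v"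
      by (auto simp: coord_space_def)
    have "Suc i \<in> A" if "i < n" "y $ i \<noteq> 0" for i
      using that v(2) diagonal_mult_vec[OF c v(1) that(1)] y by auto
    then show "y \<in> coord_space n A"
      using y c(1) v(1) by (auto simp: coord_space_def)
  next
    fix y assume y: "y \<in> coord_space n A"
    define v where "v = vec n (\<lambda>i. y $ i / D $$ (i, i))"
    have v: "v \<in> carrier_vec n"
      by (simp add: v_def)
    have "v \<in> coord_space n A"
      using y by (auto simp: coord_space_def v_def)
    moreover have "y = D *\<^sub>v v"
    proof (rule eq_vecI)
      fix i assume "i < dim_vec (D *\<^sub>v v)"
      then have "i < n"
        using c(1) by simp
      then show "y $ i = (D *\<^sub>v v) $ i"
        using diagonal_mult_vec[OF c v] torus_diagonal_nonzero[OF D] by (simp add: v_def)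
    qed (use y c(1) in \<open>simp add: coord_space_def\<close>)
    ultimately show "y \<in> (\<lambda>v. D *\<^sub>v v) ` coord_space n A"
      by blast
  qed
qed

lemma act_flag_perm_flag:
  assumes "w permutes {1..n}" and "D \<in> torus n"
  shows "act_flag D (perm_flag n w) = perm_flag n w"
  by (rule ext) (simp add: act_flag_def perm_flag_eq_coord_space[OF assms(1)] torus_image_coord_space[OF assms(2)])

text \<open>If \<open>v\<close> in \<open>W\<close> has a non-zero entry \<open>i\<close>, let
  \<open>D\<close> double that coordinate and fix the others. The difference of the image of
  \<open>v\<close> under \<open>D\<close> and \<open>v\<close> is \<open>v $ i\<close> times the
  unit vector, which therefore lies in \<open>W\<close>.\<close>

lemma torus_invariant_eq_coord_space:
  assumes W: "Csub n W" and inv: "\<And>D. D \<in> torus n \<Longrightarrow> (\<lambda>v. D *\<^sub>v v) ` W = W"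
  shows "W = coord_space n {i \<in> {1..n}. unit_vec n (i - 1) \<in> W}"
proof
  show "coord_space n {i \<in> {1..n}. unit_vec n (i - 1) \<in> W} \<subseteq> W"
    using W by (rule coord_space_subset) auto
  show "W \<subseteq> coord_space n {i \<in> {1..n}. unit_vec n (i - 1) \<in> W}"
  proof
    fix v assume v: "v \<in> W"
    then have vc: "v \<in> carrier_vec n"
      using W by (auto simp: Csub_iff)
    have "unit_vec n i \<in> W" if i: "i < n" "v $ i \<noteq> 0" for i
    proof -
      let ?D = "diag_of n (\<lambda>j. if j = i then 2 else 1)"
      have "?D *\<^sub>v v \<in> W"
        using inv[of ?D] diag_of_in_torus[of "\<lambda>j. if j = i then 2 else 1" n] v
        by (metis imageI one_neq_zero zero_neq_numeral)
      then have "inverse (v $ i) \<cdot>\<^sub>v (?D *\<^sub>v v + (- 1) \<cdot>\<^sub>v v) \<in> W"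
        using W v by (auto simp: Csub_iff)
      moreover have "inverse (v $ i) \<cdot>\<^sub>v (?D *\<^sub>v v + (- 1) \<cdot>\<^sub>v v) = unit_vec n i"
      proof (rule eq_vecI)
        fix j assume "j < dim_vec (unit_vec n i)"
        then have j: "j < n"
          by simp
        then show "(inverse (v $ i) \<cdot>\<^sub>v (?D *\<^sub>v v + (- 1) \<cdot>\<^sub>v v)) $ j = unit_vec n i $ j"
          using diagonal_mult_vec[of ?D n v j] vc i by (auto simp del: index_mult_mat_vec)
      qed (use vc in simp)
      ultimately show ?thesis
        by simp
    qed
    then show "v \<in> coord_space n {i \<in> {1..n}. unit_vec n (i - 1) \<in> W}"
      using vc by (auto simp: coord_space_def)
  qed
qed

text \<open>Each \<open>F k\<close> is the coordinate subspace of a set \<open>S k\<close> with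
  \<open>min k n\<close> elements. These sets grow by one element at a time up to
  \<open>{1..n}\<close>, and \<open>w k\<close> is the element added at step
  \<open>k\<close>.\<close>

lemma torus_fixed_flag_is_perm_flag:
  assumes F: "complete_flag n F" and fixed: "\<And>D. D \<in> torus n \<Longrightarrow> act_flag D F = F"
  shows "\<exists>w. w permutes {1..n} \<and> F = perm_flag n w"
proof -
  have sub: "Csub n (F k)" and dim: "Cdim n (F k) = min k n" and mono: "F k \<subseteq> F (Suc k)" for k
    using F by (simp_all add: complete_flag_def)
  define S where "S k = {i \<in> {1..n}. unit_vec n (i - 1) \<in> F k}" for k
  have FS: "F k = coord_space n (S k)" for k
    unfolding S_def
  proof (rule torus_invariant_eq_coord_space[OF sub])
    fix D assume "D \<in> torus n"
    then show "(\<lambda>v. D *\<^sub>v v) ` F k = F k"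
      using fixed[of D] unfolding act_flag_def fun_eq_iff by blast
  qed
  have S_in: "S k \<subseteq> {1..n}" and fin: "finite (S k)" for k
    by (auto simp: S_def)
  have card: "card (S k) = min k n" for k
    using dim[of k] S_in[of k] unfolding FS Cdim_coord_space by (simp add: Int_absorb2)
  have S_mono: "S k \<subseteq> S (Suc k)" for k
    using mono[of k] by (auto simp: S_def)
  have step: "\<exists>x. S (Suc k) = insert x (S k)" if "k < n" for k
  proof -
    have "card (S (Suc k) - S k) = 1"
      using card_Diff_subset[OF fin S_mono] that by (simp add: card)
    then obtain x where "S (Suc k) - S k = {x}"
      using card_1_singletonE by blast
    then show ?thesis
      using S_mono[of k] by blast
  qed
  \<comment> \<open>Outside \<open>{1..n}\<close> the map has to be the identity for
    \<open>permutes\<close> to hold.\<close>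
  define w where "w k = (if k \<in> {1..n} then SOME x. S k = insert x (S (k - 1)) else k)" for k
  have w_step: "S (Suc k) = insert (w (Suc k)) (S k)" if "k < n" for k
    using someI_ex[OF step[OF that]] that by (simp add: w_def)
  have w_image: "w ` {1..k} = S k" if "k \<le> n" for k
    using that
  proof (induction k)
    case 0
    then show ?case
      using card[of 0] fin[of 0] by simp
  next
    case (Suc k)
    then show ?case
      using w_step[of k] by (simp add: atLeastAtMostSuc_conv)
  qed
  have Sn: "S n = {1..n}"
    using card_subset_eq[OF _ S_in[of n]] card[of n] by simp
  have "inj_on w {1..n}"
    using w_image[of n] Sn by (intro eq_card_imp_inj_on) simp_all
  then have "bij_betw w {1..n} {1..n}"
    using w_image[of n] Sn by (simp add: bij_betw_def)
  then have w: "w permutes {1..n}"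
    by (rule bij_imp_permutes) (auto simp: w_def)
  have "S k = w ` {1..min k n}" for k
  proof (cases "k \<le> n")
    case True
    then show ?thesis
      using w_image[of k] by (simp add: min_def)
  next
    case False
    then have "card (S k) = card {1..n}"
      using card[of k] by simp
    then have "S k = {1..n}"
      using card_subset_eq[OF _ S_in[of k]] by simp
    then show ?thesis
      using False w_image[of n] Sn by (simp add: min_def)
  qed
  then have "F = perm_flag n w"
    by (intro ext) (simp add: FS perm_flag_eq_coord_space[OF w])
  then show ?thesis
    using w by blast
qed

subsection \<open>Ranks on complementary sets of rows\<close>

lemma complete_flag_mono:
  assumes "complete_flag n F" and "k \<le> l"
  shows "F k \<subseteq> F l"
  using assms(2) by (rule lift_Suc_mono_le[rotated]) (use assms(1) in \<open>simp add: complete_flag_def\<close>)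

text \<open>Choose \<open>f k\<close> in \<open>F (Suc k)\<close> but not in \<open>F k\<close> and
  take these vectors as columns. Since \<open>flag_rank\<close> selects a representative with
  \<open>SOME\<close>, its value can be computed only once a representative is known to
  exist.\<close>

lemma represents_exists:
  assumes F: "complete_flag n F"
  shows "\<exists>M. represents n M F"
proof -
  have sub: "Csub n (F k)" and dim: "Cdim n (F k) = min k n" and mono: "F k \<subseteq> F (Suc k)" for k
    using F by (simp_all add: complete_flag_def)
  have Fc: "F k \<subseteq> carrier_vec n" for k
    using sub[of k] by (simp add: Csub_iff)
  have "\<exists>v. v \<in> F (Suc k) \<and> v \<notin> F k" if "k < n" for k
    using mono[of k] dim[of k] dim[of "Suc k"] that by (cases "F k = F (Suc k)") auto
  then obtain f where f: "\<And>k. k < n \<Longrightarrow> f k \<in> F (Suc k)" "\<And>k. k < n \<Longrightarrow> f k \<notin> F k"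
    by metis
  have fc: "f k \<in> carrier_vec n" if "k < n" for k
    using f(1)[OF that] Fc by blast
  have span: "LinearCombinations.module.span class_ring (Cvs n) (f ` {..<k}) = F k" if "k \<le> n" for k
    using that
  proof (induction k)
    case 0
    have "Csub n {0\<^sub>v n}" "{0\<^sub>v n} \<subseteq> F 0"
      using sub[of 0] by (auto simp: Csub_iff)
    then have "{0\<^sub>v n} = F 0"
      using dim[of 0] Cdim_zero by (intro Cdim_eq_imp_eq[OF sub]) simp_all
    moreover interpret V: vec_space "TYPE(complex)" n .
    have "V.span {} = {0\<^sub>v n}"
      using V.span_empty by simp
    ultimately show ?case
      by simp
  next
    case (Suc k)
    let ?X = "LinearCombinations.module.span class_ring (Cvs n) (f ` {..<Suc k})"
    have c: "f ` {..<Suc k} \<subseteq> carrier_vec n"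
      using Suc.prems fc by auto
    then have X: "Csub n ?X" "f ` {..<Suc k} \<subseteq> ?X"
      by (rule Csub_span, rule in_own_span_Cvs)
    have "f ` {..<Suc k} \<subseteq> F (Suc k)"
    proof
      fix v assume "v \<in> f ` {..<Suc k}"
      then obtain j where j: "j < Suc k" "v = f j"
        by blast
      then have "v \<in> F (Suc j)"
        using f(1) Suc.prems by simp
      moreover have "F (Suc j) \<subseteq> F (Suc k)"
        using j(1) by (intro complete_flag_mono[OF F]) simp
      ultimately show "v \<in> F (Suc k)"
        by blast
    qed
    then have XF: "?X \<subseteq> F (Suc k)"
      by (rule span_subset_Csub[OF sub])
    have FX: "F k \<subseteq> ?X"
    proof -
      have "f ` {..<k} \<subseteq> ?X"
        using X(2) by fastforce
      then have "LinearCombinations.module.span class_ring (Cvs n) (f ` {..<k}) \<subseteq> ?X"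
        by (rule span_subset_Csub[OF X(1)])
      then show ?thesis
        using Suc by (simp only: Suc_leD)
    qed
    have "f k \<in> ?X" "f k \<notin> F k"
      using X(2) f(2)[of k] Suc.prems by auto
    \<comment> \<open>The span contains \<open>F k\<close> strictly and lies in
      \<open>F (Suc k)\<close>, whose dimension is only one larger.\<close>
    then have "Cdim n (F k) \<noteq> Cdim n ?X"
      using Cdim_eq_imp_eq[OF X(1) sub FX] by blast
    then have "Suc k \<le> Cdim n ?X"
      using Cdim_mono[OF X(1) sub FX] dim[of k] Suc.prems by simp
    then have "Cdim n ?X = Cdim n (F (Suc k))"
      using Cdim_mono[OF sub X(1) XF] dim[of "Suc k"] Suc.prems by simp
    then show ?case
      by (rule Cdim_eq_imp_eq[OF sub X(1) XF])
  qed
  \<comment> \<open>Equality of flags also concerns indices beyond \<open>n\<close>, where the flag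
    is constant.\<close>
  have top: "F n = F k" if "n \<le> k" for k
    using complete_flag_mono[OF F that] dim[of n] dim[of k] that
    by (intro Cdim_eq_imp_eq[OF sub sub]) simp_all
  define M where "M = mat_of_cols n (map f [0..<n])"
  have M: "M \<in> carrier_mat n n"
    by (simp add: M_def mat_of_cols_def)
  have cols: "cols M = map f [0..<n]"
    unfolding M_def using fc by (intro cols_mat_of_cols) auto
  have "set (take k (cols M)) = f ` {..<min k n}" for k
    unfolding cols by (auto simp: take_map min_def)
  then have "flag_of_mat n M k = F (min k n)" for k
    unfolding flag_of_mat_def using span[of "min k n"] by simp
  then have flag: "flag_of_mat n M k = F k" for k
    using top[of k] by (cases "k \<le> n") (simp_all add: min_def)
  have "F n = carrier_vec n"
    using dim[of n] Cdim_carrier[of n] Fc by (intro Cdim_eq_imp_eq[OF _ sub]) (auto simp: Csub_iff)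
  moreover have "set (cols M) = f ` {..<n}"
    unfolding cols by auto
  ultimately have "invertible_mat M"
    using span[of n] by (intro invertible_mat_if_span[OF M]) simp
  then show ?thesis
    unfolding represents_def using M flag by (intro exI[of _ M]) (simp add: fun_eq_iff)
qed

lemma linear_map_pick:
  assumes W: "Csub n W" and I: "\<And>i. i < m \<Longrightarrow> pick I i < n"
  shows "linear_map class_ring ((Cvs n)\<lparr>carrier := W\<rparr>) (Cvs m) (\<lambda>v. vec m (\<lambda>i. v $ pick I i))"
proof -
  interpret V: vec_space "TYPE(complex)" n .
  have W': "vectorspace class_ring ((Cvs n)\<lparr>carrier := W\<rparr>)"
    using W by (rule V.subspace_is_vs)
  have dim: "dim_vec v = n" if "v \<in> W" for v
    using W that by (auto simp: Csub_iff)
  have "(\<lambda>v. vec m (\<lambda>i. v $ pick I i)) \<in>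
      LinearCombinations.module_hom class_ring ((Cvs n)\<lparr>carrier := W\<rparr>) (Cvs m)"
    unfolding LinearCombinations.module_hom_def
    by (auto simp: module_vec_simps class_ring_simps dim I intro!: eq_vecI)
  then show ?thesis
    using W' vec_vs[where 'a = complex and n = m]
    by (intro linear_map.intro mod_hom.intro mod_hom_axioms.intro)
      (auto dest: vectorspace.axioms(1))
qed

text \<open>A vector of \<open>F k\<close> vanishing on the rows in \<open>S\<close> and on those in
  \<open>T\<close> is zero, so the two coordinate projections meet the condition of
  \<open>dim_le_sum_of_images\<close>.\<close>

lemma flag_rank_Un_ge:
  assumes F: "complete_flag n F" and k: "k \<le> n" and ST: "{1..n} \<subseteq> S \<union> T"
  shows "k \<le> flag_rank n S F k + flag_rank n T F k"
proof -
  interpret V: vec_space "TYPE(complex)" n .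
  obtain M where M: "represents n M F"
    using represents_exists[OF F] by blast
  have W: "Csub n (F k)" and dim: "Cdim n (F k) = k"
    using F k by (simp_all add: complete_flag_def)
  define p where "p S v = vec (card {i. i < n \<and> Suc i \<in> S}) (\<lambda>i. v $ pick {i. Suc i \<in> S} i)"
    for S and v :: "complex vec"
  have lin: "linear_map class_ring ((Cvs n)\<lparr>carrier := F k\<rparr>) (Cvs (card {i. i < n \<and> Suc i \<in> S})) (p S)" for S
    unfolding p_def by (rule linear_map_pick[OF W]) (rule pick_le, simp)
  have zero: "v $ i = 0" if "p S v = 0\<^sub>v (card {i. i < n \<and> Suc i \<in> S})" "i < n" "Suc i \<in> S" for S v i
  proof -
    let ?j = "card {a \<in> {i. Suc i \<in> S}. a < i}"
    have "{a \<in> {i. Suc i \<in> S}. a < i} \<subset> {i. i < n \<and> Suc i \<in> S}"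
      using that by auto
    then have "?j < card {i. i < n \<and> Suc i \<in> S}"
      by (intro psubset_card_mono) auto
    then have "p S v $ ?j = v $ i" and "0\<^sub>v (card {i. i < n \<and> Suc i \<in> S}) $ ?j = (0 :: complex)"
      using pick_card_in_set[of i "{i. Suc i \<in> S}"] that(3) by (simp_all add: p_def)
    then show ?thesis
      using that(1) by simp
  qed
  have "v = 0\<^sub>v n" if v: "v \<in> F k" "p S v = 0\<^sub>v (card {i. i < n \<and> Suc i \<in> S})"
    "p T v = 0\<^sub>v (card {i. i < n \<and> Suc i \<in> T})" for v
  proof (rule eq_vecI)
    fix i assume "i < dim_vec (0\<^sub>v n :: complex vec)"
    then have i: "i < n"
      by simp
    then have "Suc i \<in> {1..n}"
      by simp
    then have "Suc i \<in> S \<union> T"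
      using ST by blast
    then show "v $ i = 0\<^sub>v n $ i"
      using zero[OF v(2) i] zero[OF v(3) i] i by auto
  qed (use v(1) W in \<open>auto simp: Csub_iff\<close>)
  then have "Cdim n (F k) \<le> Cdim (card {i. i < n \<and> Suc i \<in> S}) (p S ` F k) +
      Cdim (card {i. i < n \<and> Suc i \<in> T}) (p T ` F k)"
    using dim_le_sum_of_images[OF lin lin V.subspace_fin_dim[OF V.fin_dim W] vec_space.fin_dim, of S T]
    by (simp add: module_vec_simps)
  then show ?thesis
    unfolding dim flag_rank_eq_Cdim[OF M k] p_def .
qed

subsection \<open>Counting small values\<close>

declare sum_of_bool_eq [simp del]

text \<open>For injective \<open>x\<close> this is the size of \<open>x[k]\<close> intersected with
  \<open>[1, i)\<close>. It is an integer so that differences may be negative, and a sum over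
  positions so that two permutations can be compared termwise.\<close>

definition count_below :: "(nat \<Rightarrow> nat) \<Rightarrow> nat \<Rightarrow> nat \<Rightarrow> int"
  where "count_below x k i = (\<Sum>r = 1..k. of_bool (x r < i))"

text \<open>The transposition either leaves all positions up to \<open>k\<close> in place or
  permutes them among themselves.\<close>

lemma count_below_outside:
  assumes "1 \<le> p" and "p < q" and "k < p \<or> q \<le> k"
  shows "count_below (x \<circ> Transposition.transpose p q) k i = count_below x k i"
proof (cases "k < p")
  case True
  then show ?thesis
    unfolding count_below_def using assms by (intro sum.cong) (auto simp: Transposition.transpose_def)
next
  case False
  then have "Transposition.transpose p q permutes {1..k}"
    using assms by (intro permutes_swap_id) auto
  then show ?thesis
    unfolding count_below_def using sum.permute[of _ "{1..k}" "\<lambda>r. of_bool (x r < i) :: int"]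
    by (simp add: o_def)
qed

lemma count_below_inside:
  assumes "1 \<le> p" and "p \<le> k" and "k < q"
  shows "count_below (x \<circ> Transposition.transpose p q) k i =
    count_below x k i - of_bool (x p < i) + of_bool (x q < i)"
proof -
  have p: "p \<in> {1..k}"
    using assms by simp
  have "(\<Sum>r\<in>{1..k} - {p}. of_bool ((x \<circ> Transposition.transpose p q) r < i)) =
      (\<Sum>r\<in>{1..k} - {p}. of_bool (x r < i) :: int)"
    using assms by (intro sum.cong) (auto simp: Transposition.transpose_def)
  then show ?thesis
    unfolding count_below_def using p by (simp add: sum.remove[of _ p])
qed

lemma count_below_one:
  assumes "x permutes {1..n}" and "k \<le> n"
  shows "count_below x k 1 = 0"
proof -
  have "x r \<noteq> 0" if "r \<in> {1..k}" for r
    using permutes_in_image[OF assms(1), of r] that assms(2) by simp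
  then show ?thesis
    unfolding count_below_def by (simp add: sum.neutral)
qed

text \<open>Together with \<open>count_below_one\<close> this makes differences of counts of two
  permutations agree at \<open>i = 1\<close> and \<open>i = Suc n\<close>, which closes the cycle of
  thresholds.\<close>

lemma count_below_top:
  assumes "x permutes {1..n}" and "k \<le> n"
  shows "count_below x k (Suc n) = int k"
proof -
  have "x r \<le> n" if "r \<in> {1..k}" for r
    using permutes_in_image[OF assms(1), of r] that assms(2) by simp
  then have "count_below x k (Suc n) = (\<Sum>r = 1..k. 1)"
    unfolding count_below_def by (intro sum.cong) (auto simp: less_Suc_eq_le)
  then show ?thesis
    by simp
qed

subsection \<open>Lengths\<close>

lemma perm_length_eq_sum:
  "int (perm_length n x) = (\<Sum>a = 1..n. \<Sum>b = 1..n. of_bool (a < b \<and> x b < x a))"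
proof -
  have "{(i, j). 1 \<le> i \<and> i < j \<and> j \<le> n \<and> x j < x i} =
      {z \<in> {1..n} \<times> {1..n}. fst z < snd z \<and> x (snd z) < x (fst z)}"
    by auto
  then have "int (perm_length n x) =
      (\<Sum>z\<in>{1..n} \<times> {1..n}. of_bool (fst z < snd z \<and> x (snd z) < x (fst z)))"
    unfolding perm_length_def by (simp add: sum_of_bool_eq Int_def)
  then show ?thesis
    by (simp add: sum.cartesian_product case_prod_unfold)
qed

text \<open>Pairs avoiding \<open>p\<close> and \<open>q\<close> keep their status, and the pair of
  \<open>p\<close> and \<open>q\<close> becomes an inversion. A third position \<open>m\<close>
  changes the count only if it lies between \<open>p\<close> and \<open>q\<close> both in position
  and in value; then both its pairs with \<open>p\<close> and \<open>q\<close> become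
  inversions.\<close>

lemma perm_length_transpose_less:
  assumes x: "x permutes {1..n}" and pq: "1 \<le> p" "p < q" "q \<le> n" and less: "x p < x q"
  shows "int (perm_length n (x \<circ> Transposition.transpose p q)) =
    int (perm_length n x) + 1 + 2 * int (card {m \<in> {p<..<q}. x p < x m \<and> x m < x q})"
proof -
  let ?y = "x \<circ> Transposition.transpose p q"
  define R where "R = {1..n} - {p, q}"
  have R: "finite R" "p \<notin> R" "q \<notin> R" "{1..n} = insert p (insert q R)" "p \<noteq> q"
    using pq by (auto simp: R_def)
  define I :: "(nat \<Rightarrow> nat) \<Rightarrow> nat \<Rightarrow> nat \<Rightarrow> int" where "I z a b = of_bool (a < b \<and> z b < z a)" for z a b
  define c where "c z m = I z m p + I z p m + I z m q + I z q m" for z m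
  have split: "int (perm_length n z) = (\<Sum>a\<in>R. \<Sum>b\<in>R. I z a b) + (\<Sum>m\<in>R. c z m) + I z p q + I z q p" for z
  proof -
    have S: "(\<Sum>a = 1..n. f a) = (\<Sum>a\<in>R. f a) + f p + f q" for f :: "nat \<Rightarrow> int"
      using R by simp
    have "int (perm_length n z) = (\<Sum>a = 1..n. \<Sum>b = 1..n. I z a b)"
      by (simp add: perm_length_eq_sum I_def)
    then show ?thesis
      unfolding S c_def sum.distrib by (simp add: I_def)
  qed
  have RR: "(\<Sum>a\<in>R. \<Sum>b\<in>R. I ?y a b) = (\<Sum>a\<in>R. \<Sum>b\<in>R. I x a b)"
    by (intro sum.cong refl) (auto simp: I_def R_def Transposition.transpose_def)
  have "c ?y m = c x m + 2 * of_bool (m \<in> {p<..<q} \<and> x p < x m \<and> x m < x q)" if "m \<in> R" for m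
  proof -
    have "x m \<noteq> x p" "x m \<noteq> x q"
      using that permutes_inj[OF x] by (auto simp: R_def inj_eq)
    moreover have "?y m = x m" "?y p = x q" "?y q = x p" "m \<noteq> p" "m \<noteq> q"
      using that by (auto simp: R_def Transposition.transpose_def)
    ultimately show ?thesis
      using less pq(2) unfolding c_def I_def of_bool_def by auto
  qed
  then have "(\<Sum>m\<in>R. c ?y m) =
      (\<Sum>m\<in>R. c x m) + 2 * (\<Sum>m\<in>R. of_bool (m \<in> {p<..<q} \<and> x p < x m \<and> x m < x q))"
    by (simp add: sum.distrib sum_distrib_left)
  also have "(\<Sum>m\<in>R. of_bool (m \<in> {p<..<q} \<and> x p < x m \<and> x m < x q)) =
      int (card (R \<inter> {m. m \<in> {p<..<q} \<and> x p < x m \<and> x m < x q}))"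
    using R(1) by (simp add: sum_of_bool_eq)
  also have "R \<inter> {m. m \<in> {p<..<q} \<and> x p < x m \<and> x m < x q} = {m \<in> {p<..<q}. x p < x m \<and> x m < x q}"
    using pq by (auto simp: R_def)
  finally show ?thesis
    using less pq(2) unfolding split RR by (simp add: I_def del: o_apply) (simp add: o_def)
qed

text \<open>The previous lemma applied to the swapped permutation, which a second swap turns back
  into \<open>x\<close>.\<close>

lemma perm_length_transpose_greater:
  assumes x: "x permutes {1..n}" and pq: "1 \<le> p" "p < q" "q \<le> n" and "x q < x p"
  shows "int (perm_length n (x \<circ> Transposition.transpose p q)) =
    int (perm_length n x) - 1 - 2 * int (card {m \<in> {p<..<q}. x q < x m \<and> x m < x p})"
proof -
  let ?t = "Transposition.transpose p q"
  have "?t permutes {1..n}"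
    using pq by (intro permutes_swap_id) auto
  then have y: "x \<circ> ?t permutes {1..n}"
    using x permutes_compose by blast
  have "{m \<in> {p<..<q}. x (?t p) < x (?t m) \<and> x (?t m) < x (?t q)} = {m \<in> {p<..<q}. x q < x m \<and> x m < x p}"
    by (auto simp: Transposition.transpose_def)
  moreover have "x \<circ> ?t \<circ> ?t = x"
    by (simp add: comp_assoc)
  ultimately show ?thesis
    using perm_length_transpose_less[OF y pq] assms(5) by simp
qed

subsection \<open>Distances in the quantum Bruhat graph\<close>

definition excess :: "(nat \<Rightarrow> nat) \<Rightarrow> (nat \<Rightarrow> nat) \<Rightarrow> nat \<Rightarrow> nat \<Rightarrow> int"
  where "excess x y k i = count_below y k i - count_below x k i"

definition max_excess :: "nat \<Rightarrow> (nat \<Rightarrow> nat) \<Rightarrow> (nat \<Rightarrow> nat) \<Rightarrow> nat \<Rightarrow> int"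
  where "max_excess n x y k = Max (excess x y k ` {1..Suc n})"

text \<open>An edge that swaps positions \<open>i < j\<close> changes the length by \<open>1\<close>
  or, if it is a quantum edge, by \<open>1 - 2 * (j - i)\<close>. So a path from \<open>x\<close> to
  \<open>y\<close> has as many edges as the difference of lengths plus twice the total of
  \<open>j - i\<close> over its quantum edges; the sum of the maxima is the least possible
  total.\<close>

definition qb_formula :: "nat \<Rightarrow> (nat \<Rightarrow> nat) \<Rightarrow> (nat \<Rightarrow> nat) \<Rightarrow> int"
  where "qb_formula n x y =
    int (perm_length n y) - int (perm_length n x) + 2 * (\<Sum>k = 1..n. max_excess n x y k)"

section \<open>The formula as a lower bound for path lengths\<close>

lemma max_excess_ge: "i \<in> {1..Suc n} \<Longrightarrow> excess x y k i \<le> max_excess n x y k"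
  unfolding max_excess_def by (rule Max_ge) auto

lemma max_excess_le_iff: "max_excess n x y k \<le> b \<longleftrightarrow> (\<forall>i\<in>{1..Suc n}. excess x y k i \<le> b)"
  unfolding max_excess_def by (subst Max_le_iff) auto

text \<open>For fixed \<open>k\<close> and \<open>i\<close> the excess is additive along
  \<open>x\<close>, \<open>y\<close>, \<open>z\<close>, and a maximum of sums is at most the sum of
  the maxima.\<close>

lemma max_excess_triangle: "max_excess n x z k \<le> max_excess n x y k + max_excess n y z k"
  unfolding max_excess_le_iff
proof
  fix i assume "i \<in> {1..Suc n}"
  then have "excess x y k i \<le> max_excess n x y k" "excess y z k i \<le> max_excess n y z k"
    by (rule max_excess_ge)+
  then show "excess x z k i \<le> max_excess n x y k + max_excess n y z k"
    by (simp add: excess_def)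
qed

lemma max_excess_self [simp]: "max_excess n x x k = 0"
  by (simp add: max_excess_def excess_def)

lemma qb_formula_self [simp]: "qb_formula n x x = 0"
  by (simp add: qb_formula_def)

lemma qb_formula_triangle: "qb_formula n x z \<le> qb_formula n x y + qb_formula n y z"
proof -
  have "(\<Sum>k = 1..n. max_excess n x z k) \<le>
      (\<Sum>k = 1..n. max_excess n x y k) + (\<Sum>k = 1..n. max_excess n y z k)"
    unfolding sum.distrib[symmetric] by (intro sum_mono max_excess_triangle)
  then show ?thesis
    by (simp add: qb_formula_def)
qed

text \<open>If \<open>w p < w q\<close>, no maximum is positive and the length grows by at most
  \<open>1\<close>. If \<open>w q < w p\<close>, the maxima are at most \<open>1\<close> for
  \<open>k\<close> in \<open>[p, q)\<close> and at most \<open>0\<close> elsewhere; the length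
  drops, so the edge is a quantum edge, and its \<open>- 2 * (q - p)\<close> offsets twice their
  sum.\<close>

lemma qb_formula_edge:
  assumes "(w, x) \<in> quantum_bruhat n"
  shows "qb_formula n w x \<le> 1"
proof -
  obtain p q where w: "w permutes {1..n}" and pq: "1 \<le> p" "p < q" "q \<le> n"
    and x: "x = w \<circ> Transposition.transpose p q"
    and len: "int (perm_length n x) = int (perm_length n w) + 1 \<or>
       int (perm_length n x) = int (perm_length n w) + 1 - 2 * (int q - int p)"
    using assms unfolding quantum_bruhat_def by blast
  have "w p \<noteq> w q"
    using pq permutes_inj[OF w] by (auto simp: inj_eq)
  then consider "w p < w q" | "w q < w p"
    by linarith
  then show ?thesis
  proof cases
    case 1
    have "max_excess n w x k \<le> 0" for k
      unfolding max_excess_le_iff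
    proof
      fix i
      show "excess w x k i \<le> 0"
        using count_below_inside[of p k q w i] count_below_outside[of p q k w i] pq 1
        by (cases "p \<le> k \<and> k < q") (auto simp: excess_def x)
    qed
    then have "(\<Sum>k = 1..n. max_excess n w x k) \<le> 0"
      by (intro sum_nonpos) auto
    then show ?thesis
      using len pq by (auto simp: qb_formula_def)
  next
    case 2
    have "max_excess n w x k \<le> of_bool (k \<in> {p..<q})" for k
      unfolding max_excess_le_iff
    proof
      fix i
      show "excess w x k i \<le> of_bool (k \<in> {p..<q})"
        using count_below_inside[of p k q w i] count_below_outside[of p q k w i] pq 2
        by (cases "p \<le> k \<and> k < q") (auto simp: excess_def x)
    qed
    then have "(\<Sum>k = 1..n. max_excess n w x k) \<le> (\<Sum>k = 1..n. of_bool (k \<in> {p..<q}))"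
      by (intro sum_mono) auto
    also have "\<dots> = int (card ({1..n} \<inter> {k. k \<in> {p..<q}}))"
      by (simp add: sum_of_bool_eq)
    also have "{1..n} \<inter> {k. k \<in> {p..<q}} = {p..<q}"
      using pq by auto
    finally have "(\<Sum>k = 1..n. max_excess n w x k) \<le> int q - int p"
      using pq by simp
    moreover have "int (perm_length n x) < int (perm_length n w)"
      using perm_length_transpose_greater[OF w pq 2] x by simp
    ultimately show ?thesis
      using len by (auto simp: qb_formula_def)
  qed
qed

lemma qb_formula_le_path:
  "(x, y) \<in> quantum_bruhat n ^^ m \<Longrightarrow> qb_formula n x y \<le> int m"
proof (induction m arbitrary: y)
  case (Suc m)
  then obtain z where z: "(x, z) \<in> quantum_bruhat n ^^ m" "(z, y) \<in> quantum_bruhat n"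
    by auto
  show ?case
    using Suc.IH[OF z(1)] qb_formula_edge[OF z(2)] qb_formula_triangle[of n x y z] by simp
qed simp

text \<open>Swap the first position \<open>p\<close> where \<open>x\<close> and \<open>y\<close> differ with the first later position
  \<open>q\<close> whose value lies in the cyclic interval from \<open>x p\<close> (excluded) to \<open>y p\<close> (included).\<close>

lemma qb_step_exists:
  assumes x: "x permutes {1..n}" and y: "y permutes {1..n}" and "x \<noteq> y"
  shows "\<exists>z. (x, z) \<in> quantum_bruhat n \<and> qb_formula n z y + 1 \<le> qb_formula n x y"
proof -
  define p where "p = (LEAST r. x r \<noteq> y r)"
  have p: "x p \<noteq> y p"
    using \<open>x \<noteq> y\<close> unfolding p_def fun_eq_iff by (metis (mono_tags, lifting) LeastI)
  have before: "x r = y r" if "r < p" for r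
    using not_less_Least that unfolding p_def by blast
  have p_in: "p \<in> {1..n}"
    using p permutes_not_in[OF x, of p] permutes_not_in[OF y, of p] by metis
  have xin: "x r \<in> {1..n} \<longleftrightarrow> r \<in> {1..n}" and yin: "y r \<in> {1..n} \<longleftrightarrow> r \<in> {1..n}" for r
    using permutes_in_image[OF x] permutes_in_image[OF y] by blast+
  have bounds: "1 \<le> x p" "x p \<le> n" "1 \<le> y p" "y p \<le> n"
    using p_in xin[of p] yin[of p] by auto
  \<comment> \<open>The cyclic interval \<open>(x p, y p]\<close>; it wraps around when
    \<open>y p < x p\<close>.\<close>
  define C where "C = (if x p < y p then {x p<..y p} else {x p<..n} \<union> {1..y p})"
  define Q where "Q r \<longleftrightarrow> p < r \<and> r \<le> n \<and> x r \<in> C" for r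
  \<comment> \<open>The position of the value \<open>y p\<close> in \<open>x\<close> is a candidate
    for \<open>q\<close>, so a least candidate exists.\<close>
  obtain q' where q': "x q' = y p"
    using permutes_surj[OF x] by (metis surjD)
  have "q' \<noteq> p"
    using q' p by auto
  moreover have "\<not> q' < p"
    using before[of q'] q' permutes_inj[OF y] by (auto simp: inj_eq)
  moreover have "q' \<in> {1..n}"
    using xin[of q'] q' bounds by simp
  ultimately have "Q q'"
    using q' bounds p by (auto simp: Q_def C_def)
  define q where "q = (LEAST r. Q r)"
  have "Q q"
    using \<open>Q q'\<close> unfolding q_def by (rule LeastI)
  then have q: "p < q" "q \<le> n" "x q \<in> C"
    by (auto simp: Q_def)
  have between: "x r \<notin> C" "x r \<in> {1..n}" if "p < r" "r < q" for r
    using that not_less_Least[of r Q] q p_in xin[of r] by (auto simp: q_def Q_def)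
  have pq: "1 \<le> p" "p < q" "q \<le> n"
    using p_in q by auto
  have xpq: "x p \<noteq> x q"
    using pq permutes_inj[OF x] by (auto simp: inj_eq)
  \<comment> \<open>Compare the two excesses position by position. Positions before \<open>p\<close>
    contribute nothing, \<open>p\<close> contributes \<open>1\<close>, and a position between
    \<open>p\<close> and \<open>q\<close> contributes at least \<open>0\<close> because its value
    under \<open>x\<close> avoids \<open>C\<close>.\<close>
  have key: "excess x y k i < excess x y k (Suc (y p))" if k: "p \<le> k" "k < q" and i: "i \<in> C" for k i
  proof -
    define f :: "nat \<Rightarrow> int" where "f r = of_bool (y r < Suc (y p)) - of_bool (x r < Suc (y p))
      - of_bool (y r < i) + of_bool (x r < i)" for r
    have "f r \<ge> of_bool (r = p)" if r: "r \<in> {1..k}" for r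
    proof -
      consider "r < p" | "r = p" | "p < r" "r < q"
        using r k by fastforce
      then show ?thesis
      proof cases
        case 1
        then show ?thesis
          using before[of r] by (simp add: f_def)
      next
        case 2
        then show ?thesis
          using i p by (auto simp: f_def C_def split: if_splits)
      next
        case 3
        then show ?thesis
          using i p between[of r] by (auto simp: f_def C_def split: if_splits)
      qed
    qed
    then have "(\<Sum>r = 1..k. f r) \<ge> (\<Sum>r = 1..k. of_bool (r = p))"
      by (rule sum_mono)
    moreover have "(\<Sum>r = 1..k. of_bool (r = p)) = (1 :: int)"
      using k p_in by (simp add: of_bool_def)
    moreover have "(\<Sum>r = 1..k. f r) = excess x y k (Suc (y p)) - excess x y k i"
      unfolding f_def excess_def count_below_def by (simp add: sum.distrib sum_subtractf)
    ultimately show ?thesis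
      by linarith
  qed
  \<comment> \<open>On \<open>C\<close> the maximum is not attained, so the excess has room to grow
    by \<open>1\<close> there.\<close>
  have key': "excess x y k i < max_excess n x y k" if k: "p \<le> k" "k < q" and i: "i \<in> C" for k i
    using key[OF that] max_excess_ge[of "Suc (y p)" n x y k] bounds by simp
  define z where "z = x \<circ> Transposition.transpose p q"
  have inside: "excess z y k i = excess x y k i + of_bool (x p < i) - of_bool (x q < i)"
    if "p \<le> k" "k < q" for k i
    using count_below_inside[of p k q x i] that pq by (simp add: excess_def z_def)
  have outside: "max_excess n z y k = max_excess n x y k" if "\<not> (p \<le> k \<and> k < q)" for k
  proof -
    have "excess z y k = excess x y k"
      using count_below_outside[of p q k x] that pq by (auto simp: excess_def z_def fun_eq_iff)
    then show ?thesis
      by (simp add: max_excess_def)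
  qed
  show ?thesis
  proof (cases "x p < x q")
    case True
    \<comment> \<open>A value strictly between \<open>x p\<close> and \<open>x q\<close> would lie
      in \<open>C\<close>, against the minimality of \<open>q\<close>.\<close>
    have "{m \<in> {p<..<q}. x p < x m \<and> x m < x q} = {}"
      using between q True by (fastforce simp: C_def split: if_splits)
    then have len: "int (perm_length n z) = int (perm_length n x) + 1"
      using perm_length_transpose_less[OF x pq True] by (simp add: z_def)
    \<comment> \<open>The swap raises the excess only for \<open>i\<close> in
      \<open>(x p, x q]\<close>, which is contained in \<open>C\<close>.\<close>
    have "max_excess n z y k \<le> max_excess n x y k" for k
    proof (cases "p \<le> k \<and> k < q")
      case k: True
      have "excess z y k i \<le> max_excess n x y k" if i: "i \<in> {1..Suc n}" for i
      proof (cases "x p < i \<and> i \<le> x q")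
        case True
        then have "i \<in> C"
          using q xin[of q] pq bounds by (auto simp: C_def split: if_splits)
        then show ?thesis
          using key'[of k i] k inside[of k i] True by auto
      next
        case False
        then show ?thesis
          using max_excess_ge[OF i, of x y k] k inside[of k i] \<open>x p < x q\<close> by auto
      qed
      then show ?thesis
        by (simp add: max_excess_le_iff)
    qed (simp add: outside)
    then have "(\<Sum>k = 1..n. max_excess n z y k) \<le> (\<Sum>k = 1..n. max_excess n x y k)"
      by (rule sum_mono)
    then have "qb_formula n z y + 1 \<le> qb_formula n x y"
      using len by (simp add: qb_formula_def)
    moreover have "(x, z) \<in> quantum_bruhat n"
      using x pq len z_def unfolding quantum_bruhat_def by blast
    ultimately show ?thesis
      by blast
  next
    case False
    then have less: "x q < x p"
      using xpq by simp
    then have wrap: "y p < x p" and xq: "x q \<le> y p"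
      using q p by (auto simp: C_def split: if_splits)
    \<comment> \<open>Values at positions between \<open>p\<close> and \<open>q\<close> avoid
      \<open>C\<close>, which now wraps around; they therefore lie between \<open>y p\<close> and
      \<open>x p\<close>. The length then drops by the largest possible amount, as a quantum edge
      demands.\<close>
    have "{m \<in> {p<..<q}. x q < x m \<and> x m < x p} = {p<..<q}"
    proof (intro equalityI subsetI)
      fix m assume m: "m \<in> {p<..<q}"
      then have "x m \<noteq> x p"
        using permutes_inj[OF x] by (auto simp: inj_eq)
      then show "m \<in> {m \<in> {p<..<q}. x q < x m \<and> x m < x p}"
        using between[of m] m wrap xq by (auto simp: C_def)
    qed auto
    then have len: "int (perm_length n z) = int (perm_length n x) + 1 - 2 * (int q - int p)"
      using perm_length_transpose_greater[OF x pq less] pq by (simp add: z_def)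
    \<comment> \<open>For \<open>i\<close> in \<open>(x q, x p]\<close> the swap lowers the excess
      by \<open>1\<close>. For all other \<open>i\<close> it leaves the excess unchanged, but there
      the maximum was not attained.\<close>
    have "max_excess n z y k \<le> max_excess n x y k - of_bool (k \<in> {p..<q})" if kn: "k \<in> {1..n}" for k
    proof (cases "p \<le> k \<and> k < q")
      case k: True
      have "excess z y k i \<le> max_excess n x y k - 1" if i: "i \<in> {1..Suc n}" for i
      proof (cases "x q < i \<and> i \<le> x p")
        case True
        then show ?thesis
          using max_excess_ge[OF i, of x y k] k inside[of k i] by auto
      next
        case False
        have "excess x y k i < max_excess n x y k"
        \<comment> \<open>The threshold \<open>Suc n\<close> is not in \<open>C\<close>, but the
          excess there equals the one at \<open>1\<close>, which is in \<open>C\<close> because of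
          the wrap.\<close>
        proof (cases "i = Suc n")
          case True
          have "excess x y k i = excess x y k 1"
            using count_below_one[OF x, of k] count_below_one[OF y, of k]
              count_below_top[OF x, of k] count_below_top[OF y, of k] kn True
            by (simp add: excess_def)
          moreover have "1 \<in> C"
            using wrap bounds by (auto simp: C_def)
          ultimately show ?thesis
            using key'[of k 1] k by simp
        next
          case neq: False
          then have "i \<in> C"
            using False i xq wrap by (auto simp: C_def)
          then show ?thesis
            using key'[of k i] k by simp
        qed
        then show ?thesis
          using inside[of k i] False less k by auto
      qed
      then have "max_excess n z y k \<le> max_excess n x y k - 1"
        unfolding max_excess_le_iff[of n z y k] by blast
      then show ?thesis
        using k by simp
    qed (simp add: outside)
    then have "(\<Sum>k = 1..n. max_excess n z y k) \<le>
        (\<Sum>k = 1..n. max_excess n x y k - of_bool (k \<in> {p..<q}))"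
      by (rule sum_mono)
    also have "\<dots> = (\<Sum>k = 1..n. max_excess n x y k) - int (card ({1..n} \<inter> {k. k \<in> {p..<q}}))"
      by (simp add: sum_subtractf sum_of_bool_eq)
    also have "{1..n} \<inter> {k. k \<in> {p..<q}} = {p..<q}"
      using pq by auto
    finally have "qb_formula n z y + 1 \<le> qb_formula n x y"
      using len pq by (simp add: qb_formula_def)
    moreover have "(x, z) \<in> quantum_bruhat n"
      using x pq len z_def unfolding quantum_bruhat_def by blast
    ultimately show ?thesis
      by blast
  qed
qed

section \<open>Shortest paths and membership in the tilted interval\<close>

lemma quantum_bruhat_permutes:
  assumes "(w, x) \<in> quantum_bruhat n"
  shows "x permutes {1..n}"
proof -
  obtain p q where "w permutes {1..n}" "1 \<le> p" "p < q" "q \<le> n" "x = w \<circ> Transposition.transpose p q"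
    using assms unfolding quantum_bruhat_def by blast
  then show ?thesis
    by (auto intro!: permutes_compose permutes_swap_id)
qed

lemma max_excess_nonneg:
  assumes "x permutes {1..n}" and "y permutes {1..n}" and "k \<le> n"
  shows "0 \<le> max_excess n x y k"
  using max_excess_ge[of 1 n x y k] assms count_below_one by (simp add: excess_def)

text \<open>Iterating \<open>qb_step_exists\<close> gives a path with at most
  \<open>qb_formula n x y\<close> edges, and \<open>qb_formula_le_path\<close> shows that it cannot
  have fewer.\<close>

lemma qb_path_exists:
  assumes "x permutes {1..n}" and y: "y permutes {1..n}"
  shows "\<exists>m. (x, y) \<in> quantum_bruhat n ^^ m \<and> int m = qb_formula n x y"
  using assms(1)
proof (induction "nat (qb_formula n x y + int (n * n))" arbitrary: x rule: less_induct)
  case less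
  show ?case
  proof (cases "x = y")
    case True
    then show ?thesis
      by (intro exI[of _ 0]) simp
  next
    case False
    then obtain z where z: "(x, z) \<in> quantum_bruhat n" "qb_formula n z y + 1 \<le> qb_formula n x y"
      using qb_step_exists[OF less.prems y] by blast
    have zp: "z permutes {1..n}"
      using z(1) by (rule quantum_bruhat_permutes)
    \<comment> \<open>That the formula is non-negative is not yet known; adding
      \<open>n * n\<close>, a bound for every length, keeps the measure from being truncated by
      \<open>nat\<close>.\<close>
    have "perm_length n z \<le> card ({1..n} \<times> {1..n})"
      unfolding perm_length_def by (intro card_mono) auto
    then have "perm_length n z \<le> n * n"
      by simp
    moreover have "0 \<le> (\<Sum>k = 1..n. max_excess n z y k)"
      by (intro sum_nonneg max_excess_nonneg zp y) auto
    ultimately have "0 \<le> qb_formula n z y + int (n * n)"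
      unfolding qb_formula_def by linarith
    then obtain m where m: "(z, y) \<in> quantum_bruhat n ^^ m" "int m = qb_formula n z y"
      using less.hyps[of z] z zp by (auto simp del: of_nat_mult)
    have path: "(x, y) \<in> quantum_bruhat n ^^ Suc m"
      using z(1) m(1) by (rule relpow_Suc_I2)
    then show ?thesis
      using qb_formula_le_path[OF path] m(2) z(2) by (intro exI[of _ "Suc m"]) simp
  qed
qed

text \<open>The shortest path has exactly \<open>qb_formula n x y\<close> edges. In particular
  distances between permutations are finite, so the \<open>enat\<close> equation of the tilted
  interval becomes one of integers.\<close>

lemma qb_dist_eq:
  assumes "x permutes {1..n}" and "y permutes {1..n}"
  obtains m where "qb_dist n x y = enat m" and "int m = qb_formula n x y"
proof -
  obtain m where m: "(x, y) \<in> quantum_bruhat n ^^ m" "int m = qb_formula n x y"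
    using qb_path_exists[OF assms] by blast
  have "qb_dist n x y = enat m"
    unfolding qb_dist_def
  proof (rule antisym)
    show "(INF m\<in>{m. (x, y) \<in> quantum_bruhat n ^^ m}. enat m) \<le> enat m"
      using m(1) by (intro INF_lower) simp
    show "enat m \<le> (INF m\<in>{m. (x, y) \<in> quantum_bruhat n ^^ m}. enat m)"
      using qb_formula_le_path[of x y _ n] m(2) by (intro INF_greatest) fastforce
  qed
  then show thesis
    using m(2) that by blast
qed

text \<open>The lengths cancel in the sum of the two distances. What remains is a vanishing sum over
  \<open>k\<close> of terms that are non-negative by the triangle inequality, so each term is
  zero.\<close>

lemma tilted_interval_iff:
  assumes u: "u permutes {1..n}" and v: "v permutes {1..n}" and w: "w permutes {1..n}"
  shows "w \<in> tilted_interval n u v \<longleftrightarrow>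
    (\<forall>k\<in>{1..n}. max_excess n u w k + max_excess n w v k = max_excess n u v k)"
proof -
  obtain a where a: "qb_dist n u w = enat a" "int a = qb_formula n u w"
    using qb_dist_eq[OF u w] by blast
  obtain b where b: "qb_dist n w v = enat b" "int b = qb_formula n w v"
    using qb_dist_eq[OF w v] by blast
  obtain c where c: "qb_dist n u v = enat c" "int c = qb_formula n u v"
    using qb_dist_eq[OF u v] by blast
  let ?d = "\<lambda>k. max_excess n u w k + max_excess n w v k - max_excess n u v k"
  have "w \<in> tilted_interval n u v \<longleftrightarrow> int a + int b = int c"
    using w a(1) b(1) c(1) by (simp add: tilted_interval_def) linarith
  also have "\<dots> \<longleftrightarrow> (\<Sum>k = 1..n. ?d k) = 0"
    unfolding a b c qb_formula_def by (simp add: sum.distrib sum_subtractf) linarith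
  also have "\<dots> \<longleftrightarrow> (\<forall>k\<in>{1..n}. ?d k = 0)"
    using max_excess_triangle[of n u v _ w] by (intro sum_nonneg_eq_0_iff) auto
  finally show ?thesis
    by simp
qed

subsection \<open>The shifted Gale order\<close>

lemma card_filter_nth:
  assumes "distinct xs"
  shows "card {x \<in> set xs. P x} = card {m. m < length xs \<and> P (xs ! m)}"
proof -
  have "card {x \<in> set xs. P x} = length (filter P xs)"
    using distinct_card[OF distinct_filter[OF assms, of P]] by simp
  then show ?thesis
    by (simp add: length_filter_conv_card)
qed

text \<open>If the entrywise comparison fails at position \<open>m\<close>, take the threshold
  \<open>as ! m\<close>: at least \<open>m + 1\<close> entries of \<open>bs\<close> lie below it,
  but at most \<open>m\<close> entries of \<open>as\<close>. So thresholds from any \<open>T\<close>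
  containing the entries of \<open>as\<close> suffice.\<close>

lemma list_all2_le_iff_card:
  assumes R: "irreflp R" "transp R" "totalp R"
    and as: "sorted_wrt R as" and bs: "sorted_wrt R bs" and len: "length as = length bs"
    and T: "set as \<subseteq> T"
  shows "list_all2 (\<lambda>x y. R x y \<or> x = y) as bs \<longleftrightarrow>
    (\<forall>t\<in>T. card {y \<in> set bs. R y t} \<le> card {x \<in> set as. R x t})"
proof -
  have distinct: "distinct xs" if "sorted_wrt R xs" for xs
    using that sorted_wrt_nth_less[OF that] R(1) unfolding irreflp_def distinct_conv_nth
    by (metis linorder_neqE_nat)
  show ?thesis
    unfolding card_filter_nth[OF distinct[OF as]] card_filter_nth[OF distinct[OF bs]]
  proof
    assume *: "list_all2 (\<lambda>x y. R x y \<or> x = y) as bs"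
    show "\<forall>t\<in>T. card {m. m < length bs \<and> R (bs ! m) t} \<le> card {m. m < length as \<and> R (as ! m) t}"
    proof
      fix t
      have "R (as ! m) t" if "m < length bs" "R (bs ! m) t" for m
        using list_all2_nthD2[OF * that(1)] that(2) R(2) by (metis transpE)
      then show "card {m. m < length bs \<and> R (bs ! m) t} \<le> card {m. m < length as \<and> R (as ! m) t}"
        using len by (intro card_mono) auto
    qed
  next
    assume *: "\<forall>t\<in>T. card {m. m < length bs \<and> R (bs ! m) t} \<le> card {m. m < length as \<and> R (as ! m) t}"
    show "list_all2 (\<lambda>x y. R x y \<or> x = y) as bs"
    proof (rule list_all2_all_nthI[OF len], rule ccontr)
      fix m assume m: "m < length as" and "\<not> (R (as ! m) (bs ! m) \<or> as ! m = bs ! m)"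
      then have less: "R (bs ! m) (as ! m)"
        using R(3) by (metis totalpD)
      have "R (bs ! l) (as ! m)" if "l \<le> m" for l
        using sorted_wrt_nth_less[OF bs, of l m] that less m len R(2)
        by (metis le_neq_implies_less transpE)
      then have "{..m} \<subseteq> {l. l < length bs \<and> R (bs ! l) (as ! m)}"
        using m len by auto
      then have "Suc m \<le> card {l. l < length bs \<and> R (bs ! l) (as ! m)}"
        using card_mono[of "{l. l < length bs \<and> R (bs ! l) (as ! m)}" "{..m}"] by simp
      moreover have "l < m" if "l < length as" "R (as ! l) (as ! m)" for l
        using sorted_wrt_nth_less[OF as, of m l] that R(1,2)
        by (metis irreflpD linorder_neqE_nat transpE)
      then have "{l. l < length as \<and> R (as ! l) (as ! m)} \<subseteq> {..<m}"
        by auto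
      then have "card {l. l < length as \<and> R (as ! l) (as ! m)} \<le> m"
        using card_mono[of "{..<m}"] by fastforce
      moreover have "as ! m \<in> T"
        using T m by auto
      ultimately show False
        using * by fastforce
    qed
  qed
qed

text \<open>A new element is inserted between the part of the list below it and the part above
  it.\<close>

lemma sorted_list_exists:
  assumes R: "transp R" "totalp R" and "finite A"
  shows "\<exists>xs. sorted_wrt R xs \<and> set xs = A"
  using assms(3)
proof induction
  case (insert x A)
  then obtain xs where xs: "sorted_wrt R xs" "set xs = A"
    by blast
  let ?ys = "filter (\<lambda>y. R y x) xs @ x # filter (R x) xs"
  have "sorted_wrt R ?ys"
    using xs(1) R(1) by (auto simp: sorted_wrt_append sorted_wrt_filter dest: transpD)
  moreover have "set ?ys = insert x A"
    using xs(2) insert.hyps(2) R(2) by (auto dest: totalpD)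
  ultimately show ?case
    by blast
qed simp

lemma cyc_less_order: "irreflp (cyc_less r)" "transp (cyc_less r)" "totalp (cyc_less r)"
  unfolding irreflp_on_def transp_on_def totalp_on_def cyc_less_def by auto

text \<open>Within \<open>{1..n}\<close> the cyclic interval from \<open>r\<close> to
  \<open>i\<close> consists of the elements before \<open>i\<close> in the order starting at
  \<open>r\<close>, so the entrywise comparison becomes one of threshold counts.\<close>

lemma gale_le_iff:
  assumes A: "A \<subseteq> {1..n}" and B: "B \<subseteq> {1..n}" and card: "card A = card B" and r: "r \<in> {1..n}"
  shows "gale_le r A B \<longleftrightarrow>
    (\<forall>i\<in>{1..n}. card (B \<inter> cyc_interval n r i) \<le> card (A \<inter> cyc_interval n r i))"
proof -
  have cyc: "X \<inter> cyc_interval n r i = {x \<in> X. cyc_less r x i}" if "X \<subseteq> {1..n}" "i \<in> {1..n}" for X i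
  proof -
    have "x \<in> cyc_interval n r i \<longleftrightarrow> cyc_less r x i" if "x \<in> {1..n}" for x
      using that \<open>i \<in> {1..n}\<close> r by (auto simp: cyc_interval_def cyc_less_def)
    then show ?thesis
      using that by blast
  qed
  let ?P = "\<forall>i\<in>{1..n}. card {x \<in> B. cyc_less r x i} \<le> card {x \<in> A. cyc_less r x i}"
  have length: "length xs = card (set xs)" if "sorted_wrt (cyc_less r) xs" for xs
  proof -
    have "distinct xs"
      using that by (induction xs) (auto simp: cyc_less_def)
    then show ?thesis
      by (simp add: distinct_card)
  qed
  have iff: "list_all2 (\<lambda>x y. cyc_less r x y \<or> x = y) as bs \<longleftrightarrow> ?P"
    if "sorted_wrt (cyc_less r) as" "set as = A" "sorted_wrt (cyc_less r) bs" "set bs = B" for as bs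
    using list_all2_le_iff_card[OF cyc_less_order that(1,3), of "{1..n}"] length[of as] length[of bs] that A card
    by simp
  have "gale_le r A B \<longleftrightarrow> ?P"
  proof
    assume "gale_le r A B"
    then show ?P
      using iff unfolding gale_le_def by blast
  next
    assume ?P
    moreover obtain as where "sorted_wrt (cyc_less r) as" "set as = A"
      using sorted_list_exists[OF cyc_less_order(2,3)] finite_subset[OF A] by blast
    moreover obtain bs where "sorted_wrt (cyc_less r) bs" "set bs = B"
      using sorted_list_exists[OF cyc_less_order(2,3)] finite_subset[OF B] by blast
    ultimately show "gale_le r A B"
      using iff unfolding gale_le_def by blast
  qed
  then show ?thesis
    using cyc[OF A] cyc[OF B] by simp
qed

text \<open>On \<open>{1..n}\<close> the indicator of the cyclic interval from \<open>b\<close> to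
  \<open>i\<close> is that of \<open>[1, i)\<close> minus that of \<open>[1, b)\<close>, plus
  \<open>1\<close> when the interval wraps around.\<close>

lemma card_image_Int_cyc_interval:
  assumes x: "x permutes {1..n}" and "k \<in> {1..n}" and "b \<in> {1..n}" and "i \<in> {1..n}"
  shows "int (card (x ` {1..k} \<inter> cyc_interval n b i)) =
    count_below x k i - count_below x k b + (if i < b then int k else 0)"
proof -
  have "x ` {1..k} \<inter> cyc_interval n b i = x ` ({1..k} \<inter> {r. x r \<in> cyc_interval n b i})"
    by auto
  then have "int (card (x ` {1..k} \<inter> cyc_interval n b i)) =
      int (card ({1..k} \<inter> {r. x r \<in> cyc_interval n b i}))"
    using card_image[OF inj_on_subset[OF permutes_inj[OF x] subset_UNIV]] by simp
  also have "\<dots> = (\<Sum>r = 1..k. of_bool (x r \<in> cyc_interval n b i))"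
    by (simp add: sum_of_bool_eq)
  also have "\<dots> = (\<Sum>r = 1..k. of_bool (x r < i) - of_bool (x r < b) + (if i < b then 1 else 0))"
  proof (rule sum.cong)
    fix r assume "r \<in> {1..k}"
    then have "x r \<in> {1..n}"
      using permutes_in_image[OF x, of r] assms by simp
    then show "of_bool (x r \<in> cyc_interval n b i) =
        of_bool (x r < i) - of_bool (x r < b) + (if i < b then 1 else 0 :: int)"
      by (auto simp: cyc_interval_def)
  qed simp
  finally show ?thesis
    by (simp add: sum.distrib sum_subtractf count_below_def)
qed

section \<open>Counting criteria for the tilted order\<close>

lemma tilted_le_iff_card:
  assumes u: "u permutes {1..n}" and v: "v permutes {1..n}" and a: "a \<in> {1..n} \<rightarrow> {1..n}"
  shows "tilted_le n a u v \<longleftrightarrow> (\<forall>k\<in>{1..n}. \<forall>i\<in>{1..n}.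
    card (v ` {1..k} \<inter> cyc_interval n (a k) i) \<le> card (u ` {1..k} \<inter> cyc_interval n (a k) i))"
proof -
  have sub: "x ` {1..k} \<subseteq> {1..n}" "card (x ` {1..k}) = k"
    if "x permutes {1..n}" and "k \<in> {1..n}" for x k
  proof -
    have "x ` {1..k} \<subseteq> x ` {1..n}"
      using that(2) by (intro image_mono) auto
    then show "x ` {1..k} \<subseteq> {1..n}"
      using permutes_image[OF that(1)] by simp
    show "card (x ` {1..k}) = k"
      using card_image[OF inj_on_subset[OF permutes_inj[OF that(1)] subset_UNIV], of "{1..k}"] by simp
  qed
  have "gale_le (a k) (u ` {1..k}) (v ` {1..k}) \<longleftrightarrow> (\<forall>i\<in>{1..n}.
      card (v ` {1..k} \<inter> cyc_interval n (a k) i) \<le> card (u ` {1..k} \<inter> cyc_interval n (a k) i))"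
    if k: "k \<in> {1..n}" for k
    using gale_le_iff[OF sub(1)[OF u k] sub(1)[OF v k] _ funcset_mem[OF a k]]
    unfolding sub(2)[OF u k] sub(2)[OF v k] by blast
  then show ?thesis
    unfolding tilted_le_def by blast
qed

text \<open>The wrap-around terms of \<open>u\<close> and \<open>v\<close> cancel, so the count
  inequality for \<open>i\<close> says that the excess at \<open>i\<close> is at most the one at
  \<open>a k\<close>. The threshold \<open>Suc n\<close> only repeats the value at
  \<open>1\<close>.\<close>

lemma tilted_le_iff_excess:
  assumes u: "u permutes {1..n}" and v: "v permutes {1..n}" and a: "a \<in> {1..n} \<rightarrow> {1..n}"
  shows "tilted_le n a u v \<longleftrightarrow> (\<forall>k\<in>{1..n}. max_excess n u v k = excess u v k (a k))"
proof -
  have "(\<forall>i\<in>{1..n}. card (v ` {1..k} \<inter> cyc_interval n (a k) i) \<le> card (u ` {1..k} \<inter> cyc_interval n (a k) i)) \<longleftrightarrow>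
      max_excess n u v k = excess u v k (a k)" if k: "k \<in> {1..n}" for k
  proof -
    have ak: "a k \<in> {1..n}"
      using a k by auto
    have "card (v ` {1..k} \<inter> cyc_interval n (a k) i) \<le> card (u ` {1..k} \<inter> cyc_interval n (a k) i) \<longleftrightarrow>
        excess u v k i \<le> excess u v k (a k)" if "i \<in> {1..n}" for i
      using card_image_Int_cyc_interval[OF u k ak that] card_image_Int_cyc_interval[OF v k ak that]
      unfolding excess_def by linarith
    then have "(\<forall>i\<in>{1..n}. card (v ` {1..k} \<inter> cyc_interval n (a k) i) \<le> card (u ` {1..k} \<inter> cyc_interval n (a k) i)) \<longleftrightarrow>
        (\<forall>i\<in>{1..n}. excess u v k i \<le> excess u v k (a k))"
      by blast
    also have "\<dots> \<longleftrightarrow> (\<forall>i\<in>{1..Suc n}. excess u v k i \<le> excess u v k (a k))"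
    proof -
      have "excess u v k (Suc n) = excess u v k 1"
        using count_below_one[OF u] count_below_one[OF v] count_below_top[OF u] count_below_top[OF v] k
        by (simp add: excess_def)
      moreover have "{1..Suc n} = insert (Suc n) {1..n}" "1 \<in> {1..n}"
        using k by auto
      ultimately show ?thesis
        by auto
    qed
    also have "\<dots> \<longleftrightarrow> max_excess n u v k = excess u v k (a k)"
      using max_excess_ge[of "a k" n u v k] ak unfolding max_excess_le_iff[symmetric] by force
    finally show ?thesis .
  qed
  then show ?thesis
    unfolding tilted_le_iff_card[OF assms] by blast
qed

text \<open>By \<open>u \<le>_a v\<close> the maximum for \<open>u\<close> and \<open>v\<close> is
  the excess at \<open>a k\<close>, which splits additively over \<open>w\<close>. Each of the other
  two maxima is at least its value at \<open>a k\<close>, so equality of the sums forces equality in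
  both.\<close>

lemma tilted_interval_iff_tilted_le:
  assumes u: "u permutes {1..n}" and v: "v permutes {1..n}" and w: "w permutes {1..n}"
    and a: "a \<in> {1..n} \<rightarrow> {1..n}" and le: "tilted_le n a u v"
  shows "w \<in> tilted_interval n u v \<longleftrightarrow> tilted_le n a u w \<and> tilted_le n a w v"
proof -
  have "max_excess n u w k + max_excess n w v k = max_excess n u v k \<longleftrightarrow>
      max_excess n u w k = excess u w k (a k) \<and> max_excess n w v k = excess w v k (a k)"
    if k: "k \<in> {1..n}" for k
  proof -
    have "max_excess n u v k = excess u w k (a k) + excess w v k (a k)"
      using le k unfolding tilted_le_iff_excess[OF u v a] by (simp add: excess_def)
    moreover have "a k \<in> {1..Suc n}"
      using a k by (auto dest: funcset_mem)
    then have "excess u w k (a k) \<le> max_excess n u w k" "excess w v k (a k) \<le> max_excess n w v k"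
      by (intro max_excess_ge; assumption)+
    ultimately show ?thesis
      by linarith
  qed
  then show ?thesis
    unfolding tilted_interval_iff[OF u v w] tilted_le_iff_excess[OF u w a] tilted_le_iff_excess[OF w v a]
    by blast
qed

subsection \<open>Permutation flags in tilted Richardson varieties\<close>

lemma cyc_interval_subset: "b \<in> {1..n} \<Longrightarrow> i \<in> {1..n} \<Longrightarrow> cyc_interval n b i \<subseteq> {1..n}"
  by (auto simp: cyc_interval_def)

text \<open>For \<open>b = i\<close> both intervals are empty; this case is treated separately
  wherever complements are taken.\<close>

lemma cyc_interval_complement:
  assumes "b \<in> {1..n}" and "i \<in> {1..n}" and "b \<noteq> i"
  shows "cyc_interval n i b = {1..n} - cyc_interval n b i"
  using assms by (auto simp: cyc_interval_def)

lemma card_image_Int_cyc_intervals: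
  assumes w: "w permutes {1..n}" and k: "k \<in> {1..n}" and b: "b \<in> {1..n}" "i \<in> {1..n}" "b \<noteq> i"
  shows "card (w ` {1..k} \<inter> cyc_interval n b i) + card (w ` {1..k} \<inter> cyc_interval n i b) = k"
proof -
  have "w ` {1..k} \<inter> cyc_interval n i b = w ` {1..k} - cyc_interval n b i"
    using permutes_image_subset[OF w, of k] k unfolding cyc_interval_complement[OF b] by auto
  then show ?thesis
    using card_Int_Diff[of "w ` {1..k}" "cyc_interval n b i"] card_permutes_image[OF w, of "{1..k}"] by simp
qed

lemma cyc_interval_same [simp]: "cyc_interval n b b = {}"
  by (simp add: cyc_interval_def)

text \<open>The two rank bounds add up to at least \<open>k\<close>, and the one for
  \<open>v\<close> is \<open>k\<close> minus the count of \<open>v\<close> on the complementary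
  interval.\<close>

lemma tilted_richardson_imp_tilted_le:
  assumes u: "u permutes {1..n}" and v: "v permutes {1..n}" and a: "a \<in> {1..n} \<rightarrow> {1..n}"
    and F: "F \<in> tilted_richardson n u v a"
  shows "tilted_le n a u v"
  unfolding tilted_le_iff_card[OF u v a]
proof (intro ballI)
  fix k i assume k: "k \<in> {1..n}" and i: "i \<in> {1..n}"
  have ak: "a k \<in> {1..n}"
    using a k by (rule funcset_mem)
  show "card (v ` {1..k} \<inter> cyc_interval n (a k) i) \<le> card (u ` {1..k} \<inter> cyc_interval n (a k) i)"
  proof (cases "a k = i")
    case False
    have "k \<le> flag_rank n (cyc_interval n (a k) i) F k + flag_rank n (cyc_interval n i (a k)) F k"
      using F k cyc_interval_complement[OF ak i False]
      by (intro flag_rank_Un_ge) (auto simp: tilted_richardson_def)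
    also have "\<dots> \<le> card (u ` {1..k} \<inter> cyc_interval n (a k) i) + card (v ` {1..k} \<inter> cyc_interval n i (a k))"
      using F k i by (intro add_mono) (auto simp: tilted_richardson_def)
    finally show ?thesis
      using card_image_Int_cyc_intervals[OF v k ak i False] by linarith
  qed simp
qed

text \<open>The ranks of \<open>perm_flag n w\<close> are counts for \<open>w\<close>; passing to
  the complementary interval reverses the second inequality.\<close>

lemma perm_flag_in_tilted_richardson_iff:
  assumes u: "u permutes {1..n}" and v: "v permutes {1..n}" and w: "w permutes {1..n}"
    and a: "a \<in> {1..n} \<rightarrow> {1..n}"
  shows "perm_flag n w \<in> tilted_richardson n u v a \<longleftrightarrow> tilted_le n a u w \<and> tilted_le n a w v"
proof -
  have "flag_rank n (cyc_interval n (a k) i) (perm_flag n w) k \<le> card (u ` {1..k} \<inter> cyc_interval n (a k) i) \<and>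
      flag_rank n (cyc_interval n i (a k)) (perm_flag n w) k \<le> card (v ` {1..k} \<inter> cyc_interval n i (a k)) \<longleftrightarrow>
      card (w ` {1..k} \<inter> cyc_interval n (a k) i) \<le> card (u ` {1..k} \<inter> cyc_interval n (a k) i) \<and>
      card (v ` {1..k} \<inter> cyc_interval n (a k) i) \<le> card (w ` {1..k} \<inter> cyc_interval n (a k) i)"
    if k: "k \<in> {1..n}" and i: "i \<in> {1..n}" for k i
  proof -
    have ak: "a k \<in> {1..n}"
      using a k by (rule funcset_mem)
    have rank: "flag_rank n S (perm_flag n w) k = card (w ` {1..k} \<inter> S)" if "S \<subseteq> {1..n}" for S
      using flag_rank_perm_flag[OF w _ that] k by simp
    show ?thesis
      unfolding rank[OF cyc_interval_subset[OF ak i]] rank[OF cyc_interval_subset[OF i ak]]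
      using card_image_Int_cyc_intervals[OF v k ak i] card_image_Int_cyc_intervals[OF w k ak i]
      by (cases "a k = i") (simp, linarith)
  qed
  then show ?thesis
    unfolding tilted_richardson_def tilted_le_iff_card[OF u w a] tilted_le_iff_card[OF w v a]
    using complete_flag_perm_flag[OF w] by blast
qed

theorem theorem4p4:
  fixes n :: nat and u v a :: "nat \<Rightarrow> nat"
  assumes "u permutes {1..n}"
    and "v permutes {1..n}"
    and "a \<in> {1..n} \<rightarrow> {1..n}"
  shows "(tilted_richardson n u v a \<noteq> {} \<or> open_tilted_richardson n u v a \<noteq> {}
            \<longrightarrow> tilted_le n a u v) \<and>
         (tilted_le n a u v \<longrightarrow>
            torus_fixed_points n (tilted_richardson n u v a) = perm_flag n ` tilted_interval n u v)"
proof (intro conjI impI)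
  \<comment> \<open>Equality of ranks implies the inequalities, so both non-emptiness assumptions
    reduce to one.\<close>
  have "open_tilted_richardson n u v a \<subseteq> tilted_richardson n u v a"
    by (auto simp: tilted_richardson_def open_tilted_richardson_def)
  moreover assume "tilted_richardson n u v a \<noteq> {} \<or> open_tilted_richardson n u v a \<noteq> {}"
  ultimately show "tilted_le n a u v"
    using tilted_richardson_imp_tilted_le[OF assms] by blast
next
  assume le: "tilted_le n a u v"
  have iff: "perm_flag n w \<in> tilted_richardson n u v a \<longleftrightarrow> w \<in> tilted_interval n u v"
    if "w permutes {1..n}" for w
    using perm_flag_in_tilted_richardson_iff[OF assms(1,2) that assms(3)]
      tilted_interval_iff_tilted_le[OF assms(1,2) that assms(3) le] by simp
  show "torus_fixed_points n (tilted_richardson n u v a) = perm_flag n ` tilted_interval n u v"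
  proof (intro equalityI subsetI)
    fix F assume F: "F \<in> torus_fixed_points n (tilted_richardson n u v a)"
    then have "complete_flag n F" "\<And>D. D \<in> torus n \<Longrightarrow> act_flag D F = F"
      by (auto simp: torus_fixed_points_def tilted_richardson_def)
    then obtain w where "w permutes {1..n}" "F = perm_flag n w"
      using torus_fixed_flag_is_perm_flag by blast
    then show "F \<in> perm_flag n ` tilted_interval n u v"
      using F iff by (auto simp: torus_fixed_points_def)
  next
    fix F assume "F \<in> perm_flag n ` tilted_interval n u v"
    then obtain w where w: "w \<in> tilted_interval n u v" "F = perm_flag n w"
      by blast
    then have "w permutes {1..n}"
      by (simp add: tilted_interval_def)
    then show "F \<in> torus_fixed_points n (tilted_richardson n u v a)"
      using w iff act_flag_perm_flag by (auto simp: torus_fixed_points_def)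
  qed
qed

end
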